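(* (Necessity) The growth function of any finitely generated algebra over a field is asymptotically equivalent to a constant function, or to a linear function, or to a weakly increasing function $F:\mathbb{N}\to\mathbb{N}$ with the following two properties: (i) $F'(n)\ge n+1$ for all $n$; (ii) $F'(m)\le F'(n)^2$ for all $n\ge 1$ and all $m\in\{n,\ldots,2n\}$. (Sufficiency) Conversely, if $F:\mathbb{N}\to\mathbb{N}$ is a constant function, or a linear function, or a weakly increasing function satisfying (i) and (ii), then $F$ is asymptotically equivalent to the growth function of a hereditary language. In particular, this gives a complete characterization, up to asymptotic equivalence, of the functions that occur as growth functions of finitely generated algebras, of finitely generated semigroups, and of hereditary languages: for each of these three classes, the growth functions are, up to asymptotic equivalence, exactly the constant functions, the linear functions, and the weakly increasing functions $F:\mathbb{N}\to\mathbb{N}$ satisfying (i) and (ii).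
   Context: $\mathbb{N}=\{0,1,2,\ldots\}$. For $F:\mathbb{N}\to\mathbb{N}$ the discrete derivative is $F'(n)=F(n)-F(n-1)$ for $n\ge1$ and $F'(0)=F(0)$. Asymptotic equivalence: for weakly increasing functions $f,g$ on the positive integers with values in $[1,\infty)$ (functions defined on $\mathbb{N}$ are compared at arguments $n\ge 1$), write $g\preceq f$ if there is a positive integer $C$ with $g(n)\le f(Cn)$ for all $n\ge1$; $f$ and $g$ are asymptotically equivalent if $f\preceq g$ and $g\preceq f$. A constant function means one with positive integer value; a linear function means $n\mapsto an+b$ with integers $a\ge1$, $b\ge0$ (all of these are asymptotically equivalent to $n\mapsto n$). Algebras: let $A$ be a nonzero finitely generated associative algebra over a field $k$ and $V$ a finite-dimensional $k$-subspace generating $A$ as a $k$-algebra. The growth function of $A$ with respect to $V$ is $d_V(n)=\dim_k(V^n)$, where $V^n$ here denotes the span of all $m$-fold products of elements of $V$ with $1\le m\le n$. Up to asymptotic equivalence it does not depend on $V$. Semigroups: for a nonempty semigroup $S$ generated by a finite subset $X$, the growth function is $d_X(n)=\#\bigcup_{k=1}^n X^k$; up to asymptotic equivalence it does not depend on $X$. Hereditary languages: for a finite alphabet $X$, let $X^*$ be the set of all words in $X$ and let $W\subseteq X^*$. The hereditary language $L_W(X)$ is the set of all words in $X^*$ having no subword (i.e. contiguous factor) lying in $W$. Its growth function is $d(n)=$ the number of words in $L_W(X)$ of length at most $n$. Growth functions are required to take values in $[1,\infty)$, so degenerate (empty) objects are excluded. *)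

theory Defs
  imports "HOL-Computational_Algebra.Polynomial" "HOL-Library.Sublist"
begin

section \<open>Asymptotic equivalence\<close>

text \<open>Only the values at positive arguments matter, so functions on the natural numbers and functions
  on the positive integers are treated alike.\<close>

definition growth_type :: "(nat \<Rightarrow> 'a::linordered_semidom) \<Rightarrow> bool" where
  "growth_type f \<longleftrightarrow> mono_on {1..} f \<and> (\<forall>n\<ge>1. 1 \<le> f n)"

definition growth_le :: "(nat \<Rightarrow> 'a::linordered_semidom) \<Rightarrow> (nat \<Rightarrow> 'a) \<Rightarrow> bool" where
  "growth_le g f \<longleftrightarrow> (\<exists>C\<ge>1. \<forall>n\<ge>1. g n \<le> f (C * n))"

definition growth_equiv :: "(nat \<Rightarrow> 'a::linordered_semidom) \<Rightarrow> (nat \<Rightarrow> 'a) \<Rightarrow> bool" where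
  "growth_equiv f g \<longleftrightarrow> growth_type f \<and> growth_type g \<and> growth_le f g \<and> growth_le g f"


section \<open>The model functions\<close>

text \<open>The derivative is integer-valued, so that the subtraction is not truncated.\<close>

definition discrete_deriv :: "(nat \<Rightarrow> nat) \<Rightarrow> nat \<Rightarrow> int" where
  "discrete_deriv F n = (if n = 0 then int (F 0) else int (F n) - int (F (n - 1)))"

definition constant_function :: "(nat \<Rightarrow> nat) \<Rightarrow> bool" where
  "constant_function F \<longleftrightarrow> (\<exists>c\<ge>1. \<forall>n. F n = c)"

definition linear_function :: "(nat \<Rightarrow> nat) \<Rightarrow> bool" where
  "linear_function F \<longleftrightarrow> (\<exists>a\<ge>1. \<exists>b. \<forall>n. F n = a * n + b)"

definition superlinear_model :: "(nat \<Rightarrow> nat) \<Rightarrow> bool" where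
  "superlinear_model F \<longleftrightarrow>
     mono F \<and>
     (\<forall>n. discrete_deriv F n \<ge> int n + 1) \<and>
     (\<forall>n\<ge>1. \<forall>m\<in>{n..2 * n}. discrete_deriv F m \<le> (discrete_deriv F n)\<^sup>2)"

definition model_functions :: "(nat \<Rightarrow> nat) set" where
  "model_functions = {F. constant_function F \<or> linear_function F \<or> superlinear_model F}"

definition same_up_to_growth_equiv :: "(nat \<Rightarrow> nat) set \<Rightarrow> (nat \<Rightarrow> nat) set \<Rightarrow> bool" where
  "same_up_to_growth_equiv G H \<longleftrightarrow>
     (\<forall>g\<in>G. \<exists>h\<in>H. growth_equiv g h) \<and> (\<forall>h\<in>H. \<exists>g\<in>G. growth_equiv h g)"


section \<open>Semigroups\<close>

text \<open>\<open>set_power mul X m\<close> is the set of all \<open>m\<close>-fold products of elements of \<open>X\<close>, for \<open>m \<ge> 1\<close>.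
  There need not be a unit, and there are no \<open>0\<close>-fold products.\<close>

fun set_power :: "('a \<Rightarrow> 'a \<Rightarrow> 'a) \<Rightarrow> 'a set \<Rightarrow> nat \<Rightarrow> 'a set" where
  "set_power mul X 0 = {}"
| "set_power mul X (Suc 0) = X"
| "set_power mul X (Suc (Suc m)) = {mul x y |x y. x \<in> X \<and> y \<in> set_power mul X (Suc m)}"

locale semigroup_on =
  fixes S :: "'a set" and mul :: "'a \<Rightarrow> 'a \<Rightarrow> 'a"
  assumes mul_closed: "x \<in> S \<Longrightarrow> y \<in> S \<Longrightarrow> mul x y \<in> S"
    and mul_assoc: "x \<in> S \<Longrightarrow> y \<in> S \<Longrightarrow> z \<in> S \<Longrightarrow> mul (mul x y) z = mul x (mul y z)"
begin

definition subsemigroup :: "'a set \<Rightarrow> bool" where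
  "subsemigroup T \<longleftrightarrow> T \<subseteq> S \<and> (\<forall>x\<in>T. \<forall>y\<in>T. mul x y \<in> T)"

definition generates :: "'a set \<Rightarrow> bool" where
  "generates X \<longleftrightarrow> X \<subseteq> S \<and> subsemigroup hull X = S"

end

definition semigroup_growth :: "('a \<Rightarrow> 'a \<Rightarrow> 'a) \<Rightarrow> 'a set \<Rightarrow> nat \<Rightarrow> nat" where
  "semigroup_growth mul X n = card (\<Union>k\<in>{1..n}. set_power mul X k)"

text \<open>The growth functions of the nonempty finitely generated semigroups whose carrier is a subset
  of the type \<open>'a\<close>. A finitely generated semigroup is countable, so up to isomorphism all of them
  occur for the type \<open>nat\<close>.\<close>

definition semigroup_growth_functions :: "'a itself \<Rightarrow> (nat \<Rightarrow> nat) set" where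
  "semigroup_growth_functions TYPE('a) =
     {semigroup_growth mul X |(S :: 'a set) mul X.
        semigroup_on S mul \<and> S \<noteq> {} \<and> finite X \<and> semigroup_on.generates S mul X}"


section \<open>Associative algebras\<close>

text \<open>An associative algebra, not necessarily with unit, over the field \<open>'k\<close>: its underlying vector
  space is a subspace \<open>A\<close> of an ambient vector space, while its multiplication is any
  associative bilinear operation on \<open>A\<close>, unrelated to the ambient type.\<close>

locale assoc_algebra_on = vector_space scale
  for scale :: "'k::field \<Rightarrow> 'v::ab_group_add \<Rightarrow> 'v" (infixr \<open>*s\<close> 75) +
  fixes A :: "'v set" and mul :: "'v \<Rightarrow> 'v \<Rightarrow> 'v"
  assumes subspace_carrier: "subspace A"
    and semigroup_mul: "semigroup_on A mul"
    and mul_add_left: "x \<in> A \<Longrightarrow> y \<in> A \<Longrightarrow> z \<in> A \<Longrightarrow> mul (x + y) z = mul x z + mul y z"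
    and mul_add_right: "x \<in> A \<Longrightarrow> y \<in> A \<Longrightarrow> z \<in> A \<Longrightarrow> mul x (y + z) = mul x y + mul x z"
    and mul_scale_left: "x \<in> A \<Longrightarrow> y \<in> A \<Longrightarrow> mul (c *s x) y = c *s mul x y"
    and mul_scale_right: "x \<in> A \<Longrightarrow> y \<in> A \<Longrightarrow> mul x (c *s y) = c *s mul x y"
begin

definition subalgebra :: "'v set \<Rightarrow> bool" where
  "subalgebra B \<longleftrightarrow> subspace B \<and> B \<subseteq> A \<and> (\<forall>x\<in>B. \<forall>y\<in>B. mul x y \<in> B)"

definition generating_subspace :: "'v set \<Rightarrow> bool" where
  "generating_subspace V \<longleftrightarrow>
     (\<exists>B. finite B \<and> V = span B) \<and> V \<subseteq> A \<and> subalgebra hull V = A"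

definition growth :: "'v set \<Rightarrow> nat \<Rightarrow> nat" where
  "growth V n = dim (span (\<Union>m\<in>{1..n}. set_power mul V m))"

end

text \<open>The growth functions of the nonzero finitely generated algebras over \<open>'k\<close> that live in the
  given vector space. A finitely generated algebra has countable dimension, so up to
  isomorphism all of them occur for the space \<open>'k poly\<close> with \<open>smult\<close>.\<close>

definition algebra_growth_functions ::
  "('k::field \<Rightarrow> 'v::ab_group_add \<Rightarrow> 'v) \<Rightarrow> (nat \<Rightarrow> nat) set" where
  "algebra_growth_functions scale =
     {assoc_algebra_on.growth scale mul V |A mul V.
        assoc_algebra_on scale A mul \<and> A \<noteq> {0} \<and>
        assoc_algebra_on.generating_subspace scale A mul V}"


section \<open>Hereditary languages\<close>

definition hereditary_language :: "'a set \<Rightarrow> 'a list set \<Rightarrow> 'a list set" where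
  "hereditary_language X W = {w \<in> lists X. \<not> (\<exists>u\<in>W. sublist u w)}"

definition language_growth :: "'a list set \<Rightarrow> nat \<Rightarrow> nat" where
  "language_growth L n = card {w \<in> L. length w \<le> n}"

text \<open>The growth functions of the nonempty hereditary languages over finite alphabets contained in
  \<open>'a\<close>; for the type \<open>nat\<close>, all finite alphabets occur up to renaming of letters.\<close>

definition language_growth_functions :: "'a itself \<Rightarrow> (nat \<Rightarrow> nat) set" where
  "language_growth_functions TYPE('a) =
     {language_growth (hereditary_language X W) |(X :: 'a set) W.
        finite X \<and> W \<subseteq> lists X \<and> hereditary_language X W \<noteq> {}}"

end

theory Submission
  imports Defs "HOL-Library.Nat_Bijection"
begin

text \<open>
  Necessity: choosing for each product the least word (in the length-lexicographic order) among those
  that represent it, or whose values span it, reduces algebras and semigroups to factor-closed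
  languages \<open>L\<close>. Let \<open>p n\<close> be the number of words of length \<open>n\<close> in \<open>L\<close>, so that \<open>p\<close> is the
  derivative of the growth function. Covering a word of length \<open>m \<in> {n..2 * n}\<close> by a prefix and a
  suffix of length \<open>n\<close> gives \<open>p m \<le> (p n)\<^sup>2\<close>. If \<open>p d \<le> d\<close> for a single \<open>d\<close>, then every long word
  is periodic with period at most \<open>d\<close> up to a prefix and a suffix of bounded length, so \<open>p\<close> is bounded
  and the growth is constant or linear.

  Sufficiency: let \<open>R g\<close> be the binary words in which any two occurrences of \<open>1\<close> have distance more
  than \<open>g\<close>. The words of length at most \<open>g + 1\<close> in \<open>R g\<close> contain at most one \<open>1\<close>, and \<open>R g\<close> has
  between \<open>(g + 1) ^ (n div (2 * g))\<close> and about \<open>(g + 1) ^ (n div g)\<close> words of length \<open>n\<close>. At stage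
  \<open>k\<close>, words of \<open>R (2 ^ m)\<close> are added, one at a time, until the language has exactly \<open>F (2 ^ k)\<close>
  elements; here \<open>m\<close> is the least level at which the new words have so few factors of length at
  most \<open>2 ^ i\<close>, for all \<open>i < k\<close>, that these fit into \<open>F (2 ^ (i + 1)) - F (2 ^ i)\<close>. The minimality
  of \<open>m\<close> and property (ii) of \<open>F\<close> ensure that words of length at most \<open>2 ^ (k + c)\<close> suffice.
\<close>

section \<open>Factor-closed languages\<close>

definition factor_closed :: "'a list set \<Rightarrow> bool" where
  "factor_closed L \<longleftrightarrow> (\<forall>w\<in>L. \<forall>u. sublist u w \<longrightarrow> u \<in> L)"

definition words_of_length :: "'a list set \<Rightarrow> nat \<Rightarrow> 'a list set" where
  "words_of_length L n = {w \<in> L. length w = n}"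

abbreviation num_words :: "'a list set \<Rightarrow> nat \<Rightarrow> nat" where
  "num_words L n \<equiv> card (words_of_length L n)"

lemma factor_closedD: "factor_closed L \<Longrightarrow> w \<in> L \<Longrightarrow> sublist u w \<Longrightarrow> u \<in> L"
  by (auto simp: factor_closed_def)

lemma factor_closed_take_drop: "factor_closed L \<Longrightarrow> w \<in> L \<Longrightarrow> take a (drop b w) \<in> L"
  by (meson factor_closedD sublist_drop sublist_order.order.trans sublist_take)

lemma factor_closed_take: "factor_closed L \<Longrightarrow> w \<in> L \<Longrightarrow> take a w \<in> L"
  and factor_closed_drop: "factor_closed L \<Longrightarrow> w \<in> L \<Longrightarrow> drop a w \<in> L"
  by (meson factor_closedD sublist_drop sublist_take)+

lemma factor_closed_Nil: "factor_closed L \<Longrightarrow> L \<noteq> {} \<Longrightarrow> [] \<in> L"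
  unfolding factor_closed_def by (metis ex_in_conv sublist_Nil_left)

lemma factor_closed_hereditary_language: "factor_closed (hereditary_language X W)"
  unfolding factor_closed_def
proof (intro ballI allI impI)
  fix w u assume w: "w \<in> hereditary_language X W" and u: "sublist u w"
  then have "set u \<subseteq> X"
    using set_mono_sublist[OF u] by (auto simp: hereditary_language_def lists_eq_set)
  moreover have "\<not> sublist v u" if "v \<in> W" for v
    using w u that sublist_order.order.trans[of v u w] by (auto simp: hereditary_language_def)
  ultimately show "u \<in> hereditary_language X W"
    by (auto simp: hereditary_language_def lists_eq_set)
qed

text \<open>A word outside \<open>L\<close> is itself a forbidden factor, so the whole complement
  can serve as the forbidden set.\<close>

lemma hereditary_language_of_factor_closed:
  assumes "factor_closed L" and "L \<subseteq> lists X"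
  shows "hereditary_language X (lists X - L) = L"
proof (intro equalityI subsetI)
  fix w assume "w \<in> hereditary_language X (lists X - L)"
  then show "w \<in> L"
    unfolding hereditary_language_def using sublist_order.order.refl[of w] by blast
next
  fix w assume "w \<in> L"
  with assms show "w \<in> hereditary_language X (lists X - L)"
    unfolding hereditary_language_def by (blast dest: factor_closedD)
qed

lemma finite_bounded_words: "finite X \<Longrightarrow> L \<subseteq> lists X \<Longrightarrow> finite {w \<in> L. length w \<le> n}"
  by (rule finite_subset[OF _ finite_lists_length_le[of X n]]) auto

lemma finite_words_of_length: "finite X \<Longrightarrow> L \<subseteq> lists X \<Longrightarrow> finite (words_of_length L n)"
  unfolding words_of_length_def by (rule finite_subset[OF _ finite_bounded_words[of X L n]]) auto

lemma words_of_length_0: "factor_closed L \<Longrightarrow> L \<noteq> {} \<Longrightarrow> words_of_length L 0 = {[]}"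
  using factor_closed_Nil[of L] by (auto simp: words_of_length_def)

lemma language_growth_eq_sum:
  assumes "finite X" "L \<subseteq> lists X"
  shows "language_growth L n = (\<Sum>m\<le>n. num_words L m)"
proof -
  have "{w \<in> L. length w \<le> n} = (\<Union>m\<in>{..n}. words_of_length L m)"
    by (auto simp: words_of_length_def)
  also have "card \<dots> = (\<Sum>m\<le>n. num_words L m)"
    by (rule card_UN_disjoint) (use finite_words_of_length[OF assms] in \<open>auto simp: words_of_length_def\<close>)
  finally show ?thesis
    by (simp add: language_growth_def)
qed

lemma language_growth_mono:
  assumes "finite X" "L \<subseteq> lists X" "m \<le> n"
  shows "language_growth L m \<le> language_growth L n"
  unfolding language_growth_eq_sum[OF assms(1,2)]
  by (rule sum_mono2) (use assms(3) in auto)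

text \<open>A word of length at most \<open>a + b\<close> is covered by its prefix of length \<open>a\<close> and its suffix of
  length \<open>b\<close>.\<close>

lemma num_words_le_mult:
  assumes fin: "finite X" and L: "factor_closed L" "L \<subseteq> lists X"
    and le: "a \<le> n" "b \<le> n" "n \<le> a + b"
  shows "num_words L n \<le> num_words L a * num_words L b"
proof -
  let ?f = "\<lambda>w. (take a w, drop (n - b) w)"
  have "inj_on ?f (words_of_length L n)"
  proof (rule inj_onI)
    fix v w assume vw: "v \<in> words_of_length L n" "w \<in> words_of_length L n" "?f v = ?f w"
    then have len: "length v = n" "length w = n"
      by (auto simp: words_of_length_def)
    have eq: "take a v = take a w" "drop (n - b) v = drop (n - b) w"
      using vw(3) by auto
    have "drop a v = drop a w"
    proof -
      have "drop a x = drop (a - (n - b)) (drop (n - b) x)" if "length x = n" for x :: "'a list"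
        using le that by simp
      then show ?thesis
        using eq(2) len by metis
    qed
    with eq(1) show "v = w"
      by (metis append_take_drop_id)
  qed
  moreover have "?f ` words_of_length L n \<subseteq> words_of_length L a \<times> words_of_length L b"
    using le factor_closed_take[OF L(1)] factor_closed_drop[OF L(1)]
    by (auto simp: words_of_length_def)
  ultimately have "num_words L n \<le> card (words_of_length L a \<times> words_of_length L b)"
    by (rule card_inj_on_le) (intro finite_cartesian_product finite_words_of_length[OF fin L(2)])
  then show ?thesis
    by (simp add: card_cartesian_product)
qed


section \<open>The gap theorem\<close>

text \<open>Two of the first \<open>d + 1\<close> windows of length \<open>d\<close> coincide, at
  \<open>i < j\<close> with \<open>j\<close> minimal, which forces the period
  \<open>p = j - i\<close> from \<open>i\<close> on. Let \<open>e\<close> be the first place where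
  it fails. Were \<open>e\<close> far from the end, the \<open>p\<close> windows starting at
  \<open>i, ..., j - 1\<close> and the \<open>d - p + 1\<close> windows starting at
  \<open>e - d + 1, ..., e - p + 1\<close> would be \<open>d + 1\<close> distinct factors of length
  \<open>d\<close>.\<close>

lemma periodic_decomposition:
  assumes fin: "finite X" and L: "factor_closed L" "L \<subseteq> lists X"
    and d: "num_words L d \<le> d" and w: "w \<in> L" "2 * d \<le> length w"
  obtains i p e where "i \<le> d" "1 \<le> p" "p \<le> d" "e \<le> length w" "length w \<le> e + d"
    "\<forall>t\<in>{i + p..<e}. w ! t = w ! (t - p)"
proof -
  define N where "N = length w"
  define win where "win s = take d (drop s w)" for s
  have win_in: "win s \<in> words_of_length L d" if "s + d \<le> N" for s
    using that factor_closed_take_drop[OF L(1) w(1)] by (auto simp: win_def words_of_length_def N_def)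
  have win_nth: "win s ! o' = w ! (s + o')" if "s + d \<le> N" "o' < d" for s o'
    using that by (simp add: win_def N_def)
  have finL: "finite (words_of_length L d)"
    by (rule finite_words_of_length[OF fin L(2)])
  have few: "card P \<le> d" if "inj_on win P" "\<And>s. s \<in> P \<Longrightarrow> s + d \<le> N" for P
  proof -
    have "card P \<le> num_words L d"
      using that win_in by (intro card_inj_on_le[OF that(1) _ finL]) auto
    with d show ?thesis by simp
  qed
  have "\<not> inj_on win {..d}"
    using few[of "{..d}"] w(2) by (auto simp: N_def)
  then obtain i0 j0 where ij0: "i0 < j0" "j0 \<le> d" "win i0 = win j0"
    unfolding inj_on_def by (metis atMost_iff linorder_neqE_nat)
  define j where "j = (LEAST j. \<exists>i<j. win i = win j)"
  have "\<exists>i<j. win i = win j"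
    unfolding j_def by (rule LeastI[of _ j0]) (use ij0 in blast)
  then obtain i where ij: "i < j" "win i = win j" by blast
  have jd: "j \<le> d"
    unfolding j_def using Least_le[of "\<lambda>j. \<exists>i<j. win i = win j" j0] ij0 by fastforce
  have first: "win s \<noteq> win s'" if "s < s'" "s' < j" for s s'
    using that not_less_Least[of s' "\<lambda>j. \<exists>i<j. win i = win j"] unfolding j_def by blast
  define p where "p = j - i"
  have p: "1 \<le> p" "p \<le> d" "i + p = j"
    using ij jd by (auto simp: p_def)
  \<comment> \<open>The end \<open>N\<close> of the word counts as a break, so that \<open>e\<close>
    exists even if the period never fails.\<close>
  define broken where "broken t \<longleftrightarrow> j \<le> t \<and> (t = N \<or> w ! t \<noteq> w ! (t - p))" for t
  define e where "e = (LEAST t. broken t)"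
  have jN: "j + d \<le> N"
    using jd w(2) by (simp add: N_def)
  have "broken N"
    using jN by (simp add: broken_def)
  then have e: "broken e" "e \<le> N"
    unfolding e_def by (rule LeastI, rule Least_le)
  have "\<not> broken t" if "t < e" for t
    using that unfolding e_def by (rule not_less_Least)
  then have run: "w ! t = w ! (t - p)" if "j \<le> t" "t < e" for t
    using that unfolding broken_def by blast
  \<comment> \<open>Equality of the windows at \<open>i\<close> and \<open>j\<close> gives the
    period at all positions from \<open>j\<close> to \<open>j + d - 1\<close>.\<close>
  have ejd: "j + d \<le> e"
  proof (rule ccontr)
    assume "\<not> j + d \<le> e"
    then have lt: "e < j + d" by simp
    have je: "j \<le> e" using e(1) by (simp add: broken_def)
    have "w ! (i + (e - j)) = w ! (j + (e - j))"
      using win_nth[of i "e - j"] win_nth[of j "e - j"] ij lt je jN by simp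
    moreover have "i + (e - j) = e - p" "j + (e - j) = e"
      using je p by auto
    ultimately have "w ! e = w ! (e - p)" by simp
    then show False
      using e(1) lt jN by (auto simp: broken_def)
  qed
  have "N \<le> e + d"
  proof (rule ccontr)
    assume "\<not> N \<le> e + d"
    then have room: "e + d < N" by simp
    then have viol: "w ! e \<noteq> w ! (e - p)"
      using e(1) by (auto simp: broken_def)
    define P where "P = {i..<j} \<union> {e - d + 1..e - p + 1}"
    have Pge: "i \<le> s" and PN: "s + d \<le> N" if "s \<in> P" for s
      using that ejd room p ij jN by (auto simp: P_def)
    \<comment> \<open>\<open>S s\<close> counts the letter \<open>w ! e\<close> among the
      \<open>p\<close> letters from \<open>s\<close> on. Sliding along the periodic run keeps the
      count; the slide that drops position \<open>e - p\<close> and takes in \<open>e\<close> raises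
      it by one.\<close>
    define S where "S s = (\<Sum>t<p. if w ! (s + t) = w ! e then 1 else 0 :: nat)" for s
    have S_step: "S (Suc s) + (if w ! s = w ! e then 1 else 0) = S s + (if w ! (s + p) = w ! e then 1 else 0)" for s
    proof -
      have "S s + (if w ! (s + p) = w ! e then 1 else 0) = (\<Sum>t<Suc p. if w ! (s + t) = w ! e then 1 else 0)"
        by (simp add: S_def)
      also have "\<dots> = (if w ! s = w ! e then 1 else 0) + S (Suc s)"
        unfolding S_def by (subst sum.lessThan_Suc_shift) simp
      finally show ?thesis by simp
    qed
    have S_const: "S (i + t) = S i" if "i + t + p \<le> e" for t
      using that
    proof (induction t)
      case (Suc t)
      have "w ! (i + t + p) = w ! (i + t)"
        using run[of "i + t + p"] Suc.prems p by simp
      with S_step[of "i + t"] Suc show ?case by simp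
    qed simp
    have S_last: "S (e - p + 1) = Suc (S i)"
    proof -
      have "S (e - p) = S i"
        using S_const[of "e - p - i"] ejd p by simp
      moreover have "e - p + p = e" using ejd p by simp
      ultimately show ?thesis
        using S_step[of "e - p"] viol by simp
    qed
    have neq: "win s \<noteq> win s'" if s: "s \<in> P" "s' \<in> P" "s < s'" for s s'
    proof -
      consider "s' < j" | "e - d + 1 \<le> s'" "s' \<le> e - p" | "s' = e - p + 1"
        using s(2) by (fastforce simp: P_def)
      then show ?thesis
      proof cases
        case 1
        then show ?thesis using first s by blast
      next
        case 2
        \<comment> \<open>Window \<open>s'\<close> contains both positions \<open>e - p\<close> and
          \<open>e\<close> of the violation; at the same offsets the earlier window \<open>s\<close>
          is still inside the periodic run.\<close>
        have o': "e - s' < d" "p \<le> e - s'"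
          using 2 ejd p by auto
        have "win s ! (e - s') = win s ! (e - s' - p)"
          using run[of "s + (e - s')"] win_nth[of s "e - s'"] win_nth[of s "e - s' - p"]
            PN[OF s(1)] Pge[OF s(1)] o' s(3) p 2 by simp
        moreover have "win s' ! (e - s') \<noteq> win s' ! (e - s' - p)"
          using viol win_nth[of s' "e - s'"] win_nth[of s' "e - s' - p"] PN[OF s(2)] o' 2 p
          by simp
        ultimately show ?thesis by metis
      next
        case 3
        \<comment> \<open>This window starts just after \<open>e - p\<close> and so misses one
          position of the violation; the count \<open>S\<close> of its first \<open>p\<close>
          letters distinguishes it instead.\<close>
        have "w ! (s + t) = w ! (s' + t)" if "win s = win s'" "t < p" for t
          using win_nth[of s t] win_nth[of s' t] that PN s p by simp
        then have "S s = S s'" if "win s = win s'"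
          using that unfolding S_def by (intro sum.cong) auto
        moreover have "S s = S i"
          using S_const[of "s - i"] Pge[OF s(1)] 3 s(3) ejd p by simp
        ultimately show ?thesis
          using S_last 3 by auto
      qed
    qed
    have "inj_on win P"
      unfolding inj_on_def using neq by (metis linorder_neqE_nat)
    then have "card P \<le> d"
      using few PN by blast
    moreover have "card P = p + (d - p + 1)"
      unfolding P_def using ejd p ij by (subst card_Un_disjoint) (auto simp: p_def)
    ultimately show False
      using p by simp
  qed
  with that[of i p e] p ij jd e(2) run show thesis
    by (auto simp: N_def)
qed

text \<open>The prefix fixes the positions below \<open>i + p\<close>, the period carries them on up
  to \<open>e\<close>, and the suffix fixes the rest.\<close>

lemma eq_if_periodic_on:
  fixes v w :: "'a list"
  assumes "length v = length w" "take (i + p) v = take (i + p) w" "drop e v = drop e w" "1 \<le> p"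
    and "\<forall>t\<in>{i + p..<e}. v ! t = v ! (t - p)" "\<forall>t\<in>{i + p..<e}. w ! t = w ! (t - p)"
  shows "v = w"
proof (rule nth_equalityI)
  fix t assume "t < length v"
  then show "v ! t = w ! t"
  proof (induction t rule: less_induct)
    case (less t)
    consider "t < i + p" | "i + p \<le> t" "t < e" | "e \<le> t" by linarith
    then show ?case
    proof cases
      case 1
      then show ?thesis using assms(2) by (metis nth_take)
    next
      case 2
      then show ?thesis using less assms(4-6) by simp
    next
      case 3
      then have "x ! t = drop e x ! (t - e)" if "length x = length v" for x :: "'a list"
        using less.prems that by simp
      then show ?thesis using assms(1,3) by metis
    qed
  qed
qed (use assms in simp)

text \<open>By \<open>periodic_decomposition\<close>, a long word is determined by \<open>i\<close>,
  \<open>p\<close>, the distance of \<open>e\<close> from its end, a prefix and a suffix, all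
  bounded in terms of \<open>d\<close> and \<open>X\<close>. So the number of codes does not depend
  on the length.\<close>

theorem num_words_bounded:
  assumes fin: "finite X" and L: "factor_closed L" "L \<subseteq> lists X"
    and d: "num_words L d \<le> d"
  shows "\<exists>K. \<forall>n. num_words L n \<le> K"
proof -
  let ?Q = "{u \<in> lists X. length u \<le> 2 * d}"
  define Z where "Z = {..d} \<times> {..d} \<times> {..d} \<times> ?Q \<times> ?Q"
  have finZ: "finite Z"
    unfolding Z_def using finite_bounded_words[OF fin subset_refl, of "2 * d"]
    by (intro finite_cartesian_product finite_atMost)
  define good where "good w i p e \<longleftrightarrow> i \<le> d \<and> 1 \<le> p \<and> p \<le> d \<and> e \<le> length w \<and> length w \<le> e + d
    \<and> (\<forall>t\<in>{i + p..<e}. w ! t = w ! (t - p))" for w :: "'a list" and i p e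
  have long: "num_words L n \<le> card Z" if n: "2 * d \<le> n" for n
  proof -
    have "\<exists>i p e. good w i p e" if "w \<in> words_of_length L n" for w
    proof -
      have "w \<in> L" "2 * d \<le> length w"
        using that n by (auto simp: words_of_length_def)
      then obtain i p e where "i \<le> d" "1 \<le> p" "p \<le> d" "e \<le> length w" "length w \<le> e + d"
        "\<forall>t\<in>{i + p..<e}. w ! t = w ! (t - p)"
        by (rule periodic_decomposition[OF fin L d])
      then show ?thesis unfolding good_def by blast
    qed
    then obtain fi fp fe where good: "\<And>w. w \<in> words_of_length L n \<Longrightarrow> good w (fi w) (fp w) (fe w)"
      by metis
    \<comment> \<open>The code records \<open>n - fe w\<close>, which is at most \<open>d\<close>,
      because \<open>fe w\<close> itself grows with \<open>n\<close>.\<close>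
    let ?f = "\<lambda>w. (fi w, fp w, n - fe w, take (fi w + fp w) w, drop (fe w) w)"
    have "inj_on ?f (words_of_length L n)"
    proof (rule inj_onI)
      fix v w assume vw: "v \<in> words_of_length L n" "w \<in> words_of_length L n" "?f v = ?f w"
      have len: "length v = n" "length w = n"
        using vw by (auto simp: words_of_length_def)
      note gd = good[OF vw(1), unfolded good_def len] good[OF vw(2), unfolded good_def len]
      have e: "fe v = fe w"
        using vw(3) gd by (metis (no_types, lifting) diff_diff_cancel prod.inject)
      show "v = w"
        by (rule eq_if_periodic_on[of v w "fi v" "fp v" "fe v"]) (use vw(3) gd e len in auto)
    qed
    moreover have "?f ` words_of_length L n \<subseteq> Z"
    proof (rule image_subsetI)
      fix w assume w: "w \<in> words_of_length L n"
      then have "w \<in> lists X" "length w = n"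
        using L(2) by (auto simp: words_of_length_def)
      with good[OF w] show "?f w \<in> Z"
        unfolding Z_def good_def by (auto dest: in_set_takeD in_set_dropD)
    qed
    ultimately show ?thesis
      by (rule card_inj_on_le[OF _ _ finZ])
  qed
  have "num_words L n \<le> card Z + (\<Sum>m<2*d. num_words L m)" for n
  proof (cases "2 * d \<le> n")
    case False
    then have "num_words L n \<le> (\<Sum>m<2*d. num_words L m)"
      by (intro member_le_sum) auto
    then show ?thesis by simp
  qed (use long[of n] in simp)
  then show ?thesis by blast
qed


section \<open>Growth functions of languages are equivalent to model functions\<close>

lemma growth_equivI:
  fixes f g :: "nat \<Rightarrow> nat"
  assumes "\<And>m n. 1 \<le> m \<Longrightarrow> m \<le> n \<Longrightarrow> f m \<le> f n" "\<And>n. 1 \<le> n \<Longrightarrow> 1 \<le> f n"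
    "\<And>m n. 1 \<le> m \<Longrightarrow> m \<le> n \<Longrightarrow> g m \<le> g n" "\<And>n. 1 \<le> n \<Longrightarrow> 1 \<le> g n"
    "1 \<le> C" "\<And>n. 1 \<le> n \<Longrightarrow> f n \<le> g (C * n)" "1 \<le> D" "\<And>n. 1 \<le> n \<Longrightarrow> g n \<le> f (D * n)"
  shows "growth_equiv f g"
proof -
  have "growth_type f" "growth_type g"
    unfolding growth_type_def mono_on_def atLeast_iff using assms(1-4) by blast+
  moreover have "growth_le f g" "growth_le g f"
    unfolding growth_le_def using assms(5-8) by blast+
  ultimately show ?thesis
    by (simp add: growth_equiv_def)
qed

text \<open>Needed because the semigroup built from a language has growth \<open>0\<close> at
  argument \<open>0\<close>, where the language already has the empty word.\<close>

lemma growth_equiv_cong: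
  assumes eq: "\<And>n. 1 \<le> n \<Longrightarrow> g n = h n" and fg: "growth_equiv f g"
  shows "growth_equiv f h"
proof -
  have "growth_type h \<longleftrightarrow> growth_type g"
    using eq by (auto simp: growth_type_def mono_on_def)
  moreover have "1 \<le> C * n" if "1 \<le> C" "1 \<le> n" for C n :: nat
    using that by simp
  then have "growth_le f h \<longleftrightarrow> growth_le f g" "growth_le h f \<longleftrightarrow> growth_le g f"
    unfolding growth_le_def using eq by metis+
  ultimately show ?thesis
    using fg by (simp add: growth_equiv_def)
qed

text \<open>The shift \<open>\<delta>\<close> is \<open>1\<close> for algebras and semigroups, where the empty word is not a product.\<close>

theorem language_growth_equiv_model:
  assumes fin: "finite X" and L: "factor_closed L" "L \<subseteq> lists X" "L \<noteq> {}"
    and dD: "\<And>n. 1 \<le> n \<Longrightarrow> d n + \<delta> = language_growth L n"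
    and \<delta>: "\<delta> \<le> 1" and d1: "1 \<le> d 1"
  shows "\<exists>F\<in>model_functions. growth_equiv d F"
proof -
  let ?D = "language_growth L" and ?p = "num_words L"
  have D_Suc: "?D (Suc n) = ?D n + ?p (Suc n)" for n
    by (simp add: language_growth_eq_sum[OF fin L(2)])
  have p0: "?p 0 = 1"
    by (simp add: words_of_length_0 L)
  have D0: "?D 0 = 1"
    by (simp add: language_growth_eq_sum[OF fin L(2)] p0)
  note D_mono = language_growth_mono[OF fin L(2)]
  have d_mono: "d m \<le> d n" if "1 \<le> m" "m \<le> n" for m n
    using D_mono[OF that(2)] dD[of m] dD[of n] that by simp
  have d_ge1: "1 \<le> d n" if "1 \<le> n" for n
    using d_mono[of 1 n] d1 that by simp
  have D_ge: "n + 1 \<le> ?D n" if "\<And>n. 1 \<le> ?p n" for n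
  proof (induction n)
    case (Suc n)
    then show ?case using that[of "Suc n"] D_Suc[of n] by simp
  qed (simp add: D0)
  show ?thesis
  proof (cases "\<forall>n. n + 1 \<le> ?p n")
    case True
    have deriv: "discrete_deriv ?D n = int (?p n)" for n
      by (cases n) (simp_all add: discrete_deriv_def D0 p0 D_Suc)
    have "?p m \<le> (?p n)\<^sup>2" if "m \<in> {n..2 * n}" for m n
      unfolding power2_eq_square by (rule num_words_le_mult[OF fin L(1,2)]) (use that in auto)
    moreover have "int n + 1 \<le> int (?p n)" for n
      using True by (metis of_nat_1 of_nat_add of_nat_le_iff)
    ultimately have "superlinear_model ?D"
      unfolding superlinear_model_def deriv of_nat_power[symmetric] of_nat_le_iff
      by (auto simp: mono_def intro: D_mono)
    moreover have "growth_equiv d ?D"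
    proof (rule growth_equivI[where C = 1 and D = 2])
      fix n :: nat assume n: "1 \<le> n"
      show "d n \<le> ?D (1 * n)" using dD[OF n] by simp
      \<comment> \<open>Doubling the argument gains at least one word, which pays for the shift
        \<open>\<delta>\<close>.\<close>
      have "?D n + 1 \<le> ?D (Suc n)" using True[rule_format, of "Suc n"] by (simp add: D_Suc)
      also have "\<dots> \<le> ?D (2 * n)" using n by (intro D_mono) simp
      finally show "?D n \<le> d (2 * n)" using dD[of "2 * n"] n \<delta> by simp
      show "1 \<le> ?D n" using D_mono[of 0 n] D0 by simp
    qed (auto intro: d_mono d_ge1[simplified] D_mono)
    ultimately show ?thesis
      by (auto simp: model_functions_def)
  next
    case False
    then obtain n0 where "?p n0 \<le> n0" by (auto simp: not_le less_Suc_eq_le)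
    then obtain K where K: "?p n \<le> K" for n
      using num_words_bounded[OF fin L(1,2)] by blast
    show ?thesis
    proof (cases "\<forall>n. 1 \<le> ?p n")
      case True
      have D_le: "?D n \<le> 1 + K * n" for n
      proof (induction n)
        case (Suc n)
        then show ?case using K[of "Suc n"] D_Suc[of n] by simp
      qed (simp add: D0)
      have "growth_equiv d (\<lambda>n. n)"
      proof (rule growth_equivI[where C = "1 + K" and D = 1])
        fix n :: nat assume n: "1 \<le> n"
        show "d n \<le> (1 + K) * n" using dD[OF n] D_le[of n] n by simp
        show "n \<le> d (1 * n)" using dD[OF n] D_ge[of n] True \<delta> by simp
      qed (auto intro: d_mono d_ge1[simplified])
      moreover have "linear_function (\<lambda>n. n)"
        unfolding linear_function_def by (intro exI[of _ 1] exI[of _ 0] conjI) auto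
      ultimately show ?thesis
        by (auto simp: model_functions_def)
    next
      case False
      then obtain N where N: "?p N = 0" by (auto simp: not_le)
      have N1: "1 \<le> N" using N p0 by (cases N) auto
      have p_late: "?p n = 0" if "N \<le> n" for n
      proof -
        \<comment> \<open>Every word of length at least \<open>N\<close> has a prefix of length
          \<open>N\<close>; the word itself is taken as its suffix.\<close>
        have "?p n \<le> ?p N * ?p n"
          using that by (intro num_words_le_mult[OF fin L(1,2)]) auto
        then show ?thesis using N by simp
      qed
      have D_late: "?D (N + k) = ?D N" for k
        by (induction k) (simp_all add: D_Suc p_late)
      have d_late: "d n = d N" if "N \<le> n" for n
        using dD[of N] dD[of n] D_late[of "n - N"] that N1 by simp
      have "growth_equiv d (\<lambda>n. d N)"
      proof (rule growth_equivI[where C = 1 and D = N])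
        fix n :: nat assume n: "1 \<le> n"
        show "d n \<le> d N" using d_mono[of n N] d_late[of n] n by (cases "n \<le> N") auto
        show "d N \<le> d (N * n)" using d_mono[of N "N * n"] N1 n by simp
      qed (use d_ge1[OF N1] N1 in \<open>auto intro: d_mono d_ge1[simplified]\<close>)
      moreover have "constant_function (\<lambda>n. d N)"
        using d_ge1[OF N1] by (auto simp: constant_function_def)
      ultimately show ?thesis
        by (auto simp: model_functions_def)
    qed
  qed
qed

section \<open>Sparse binary words\<close>

definition sparse_words :: "nat \<Rightarrow> nat list set" where
  "sparse_words g = {w \<in> lists {0, 1}.
     \<forall>i j. i < j \<and> j < length w \<and> w ! i = 1 \<and> w ! j = 1 \<longrightarrow> g < j - i}"

definition short_sparse_words :: "nat \<Rightarrow> nat \<Rightarrow> nat list set" where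
  "short_sparse_words g n = {w \<in> sparse_words g. length w \<le> n}"

lemma sparse_words_subset: "sparse_words g \<subseteq> lists {0, 1}"
  by (auto simp: sparse_words_def)

lemma sparse_wordsD:
  "w \<in> sparse_words g \<Longrightarrow> i < j \<Longrightarrow> j < length w \<Longrightarrow> w ! i = 1 \<Longrightarrow> w ! j = 1 \<Longrightarrow> g < j - i"
  by (auto simp: sparse_words_def)

lemma finite_sparse_words: "finite (words_of_length (sparse_words g) n)"
  by (rule finite_words_of_length[OF _ sparse_words_subset]) simp

lemma finite_short_sparse_words: "finite (short_sparse_words g n)"
  unfolding short_sparse_words_def by (rule finite_bounded_words[OF _ sparse_words_subset]) simp

lemma sparse_words_antimono: "g \<le> h \<Longrightarrow> sparse_words h \<subseteq> sparse_words g"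
  unfolding sparse_words_def by (blast intro: le_less_trans)

lemma factor_closed_sparse_words: "factor_closed (sparse_words g)"
  unfolding factor_closed_def
proof (intro ballI allI impI)
  fix w u assume w: "w \<in> sparse_words g" and "sublist u w"
  then obtain a b where ab: "w = a @ u @ b" by (auto simp: sublist_def)
  have "g < j - i" if "i < j" "j < length u" "u ! i = 1" "u ! j = 1" for i j
  proof -
    have "w ! (length a + k) = u ! k" if "k < length u" for k
      using that by (simp add: ab nth_append)
    then have "g < (length a + j) - (length a + i)"
      using that w ab unfolding sparse_words_def mem_Collect_eq
      by (metis (no_types, lifting) add_less_cancel_left length_append less_trans trans_less_add1)
    then show ?thesis by simp
  qed
  with w ab show "u \<in> sparse_words g"
    by (auto simp: sparse_words_def)
qed

lemma factor_closed_short_sparse_words: "factor_closed (short_sparse_words g n)"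
  unfolding factor_closed_def short_sparse_words_def
  using factor_closedD[OF factor_closed_sparse_words] sublist_length_le le_trans by blast

lemma num_sparse_words_Suc: "num_words (sparse_words g) n \<le> num_words (sparse_words g) (Suc n)"
proof (rule card_inj_on_le[where f = "\<lambda>w. w @ [0]"])
  show "inj_on (\<lambda>w. w @ [0]) (words_of_length (sparse_words g) n)"
    by (auto intro: inj_onI)
  show "(\<lambda>w. w @ [0]) ` words_of_length (sparse_words g) n \<subseteq> words_of_length (sparse_words g) (Suc n)"
    by (auto simp: words_of_length_def sparse_words_def nth_append split: if_splits)
qed (rule finite_sparse_words)

lemma num_sparse_words_mono: "m \<le> n \<Longrightarrow> num_words (sparse_words g) m \<le> num_words (sparse_words g) n"
  by (rule lift_Suc_mono_le[where f = "num_words (sparse_words g)"]) (rule num_sparse_words_Suc)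

lemma num_sparse_words_le:
  assumes "n \<le> Suc g"
  shows "num_words (sparse_words g) n \<le> Suc n"
proof -
  \<comment> \<open>\<open>?one j\<close> has its only \<open>1\<close> at position
    \<open>j\<close>; \<open>?one n\<close> is the word of zeros, since \<open>n\<close> is out of
    range.\<close>
  let ?one = "\<lambda>j. map (\<lambda>i. if i = j then 1 else 0 :: nat) [0..<n]"
  have "words_of_length (sparse_words g) n \<subseteq> ?one ` {..n}"
  proof
    fix w assume "w \<in> words_of_length (sparse_words g) n"
    then have w: "w \<in> sparse_words g" "length w = n"
      by (auto simp: words_of_length_def)
    have bin: "w ! i \<in> {0, 1}" if "i < n" for i
      using w that by (auto simp: sparse_words_def lists_eq_set dest: nth_mem)
    show "w \<in> ?one ` {..n}"
    proof (cases "\<exists>j<n. w ! j = 1")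
      case True
      then obtain j where j: "j < n" "w ! j = 1" by blast
      have "w ! i \<noteq> 1" if "i < n" "i \<noteq> j" for i
      proof
        assume i: "w ! i = 1"
        have "g < j - i" if "i < j"
          using that w i j unfolding sparse_words_def by blast
        moreover have "g < i - j" if "j < i"
          using that w i j \<open>i < n\<close> unfolding sparse_words_def by blast
        ultimately show False
          using \<open>i \<noteq> j\<close> \<open>i < n\<close> j(1) assms by linarith
      qed
      then have "w = ?one j"
        using w(2) j bin by (intro nth_equalityI) auto
      with j show ?thesis by auto
    next
      case False
      then have "w = ?one n"
        using w(2) bin by (intro nth_equalityI) auto
      then show ?thesis by blast
    qed
  qed
  then have "num_words (sparse_words g) n \<le> card (?one ` {..n})"
    by (rule card_mono[rotated]) simp
  also have "\<dots> \<le> Suc n"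
    using card_image_le[of "{..n}" ?one] by simp
  finally show ?thesis .
qed

text \<open>Cut the word into \<open>q\<close> blocks of length \<open>g\<close>; each contains at
  most one \<open>1\<close>, which leaves \<open>g + 1\<close> possibilities.\<close>

lemma num_sparse_words_upper: "num_words (sparse_words g) (q * g) \<le> (g + 1) ^ q"
proof (induction q)
  case 0
  then show ?case using num_sparse_words_le[of 0 g] by simp
next
  case (Suc q)
  have "num_words (sparse_words g) (Suc q * g)
      \<le> num_words (sparse_words g) g * num_words (sparse_words g) (q * g)"
    by (rule num_words_le_mult[OF _ factor_closed_sparse_words sparse_words_subset]) auto
  also have "\<dots> \<le> (g + 1) * (g + 1) ^ q"
    using Suc num_sparse_words_le[of g g] by (intro mult_le_mono) auto
  finally show ?case by simp
qed

text \<open>Concatenate \<open>q\<close> blocks of length \<open>2 * g\<close> whose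
  \<open>1\<close>, if any, lies in the first half. The zeros of the second half separate the
  \<open>1\<close>s of different blocks, so all \<open>g + 1\<close> choices per block are
  free.\<close>

lemma num_sparse_words_lower: "(g + 1) ^ q \<le> num_words (sparse_words g) (2 * g * q)"
proof (induction q)
  case 0
  have "words_of_length (sparse_words g) 0 = {[]}"
    by (auto simp: words_of_length_def sparse_words_def)
  then show ?case by simp
next
  case (Suc q)
  let ?one = "\<lambda>j. map (\<lambda>i. if i = j then 1 else 0 :: nat) [0..<2 * g]"
  \<comment> \<open>The index \<open>2 * g\<close> is out of range and stands for the block of
    zeros.\<close>
  let ?J = "insert (2 * g) {..<g}"
  let ?R = "sparse_words g" and ?m = "2 * g * q"
  let ?f = "\<lambda>(j, w). ?one j @ w"
  have one_nth: "?one j ! i = 1 \<longleftrightarrow> i = j" if "i < 2 * g" for i j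
    using that by auto
  have "inj_on ?f (?J \<times> words_of_length ?R ?m)"
  proof (rule inj_onI)
    fix x y assume xy: "x \<in> ?J \<times> words_of_length ?R ?m" "y \<in> ?J \<times> words_of_length ?R ?m" "?f x = ?f y"
    obtain j v k w where x: "x = (j, v)" and y: "y = (k, w)" by fastforce
    have eq: "?one j = ?one k" "v = w"
      using xy x y by auto
    have "j = k"
    proof (rule ccontr)
      assume "j \<noteq> k"
      then have "j < 2 * g \<or> k < 2 * g"
        using xy(1,2) x y by auto
      then show False
        using one_nth[of j j] one_nth[of j k] one_nth[of k j] one_nth[of k k] eq(1) \<open>j \<noteq> k\<close> by metis
    qed
    with eq x y show "x = y" by simp
  qed
  moreover have "?f ` (?J \<times> words_of_length ?R ?m) \<subseteq> words_of_length ?R (2 * g * Suc q)"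
  proof clarify
    fix j w assume j: "j \<in> ?J" and "w \<in> words_of_length ?R ?m"
    then have w: "w \<in> ?R" "length w = ?m"
      by (auto simp: words_of_length_def)
    let ?v = "?one j @ w"
    have "g < b - a" if ab: "a < b" "b < length ?v" "?v ! a = 1" "?v ! b = 1" for a b
    proof (cases "b < 2 * g")
      case True
      then have "?one j ! a = 1" "?one j ! b = 1"
        using ab by (auto simp: nth_append)
      then show ?thesis
        using True ab(1) one_nth by (metis less_trans nat_neq_iff)
    next
      case b: False
      show ?thesis
      proof (cases "a < 2 * g")
        case True
        then have "?one j ! a = 1"
          using ab by (auto simp: nth_append)
        then have "a < g"
          using True one_nth[of a j] j by auto
        with b show ?thesis by simp
      next
        case False
        then have "w ! (a - 2 * g) = 1" "w ! (b - 2 * g) = 1"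
          using ab b by (auto simp: nth_append)
        then have "g < (b - 2 * g) - (a - 2 * g)"
          using w ab False b by (intro sparse_wordsD[OF w(1)]) auto
        then show ?thesis by simp
      qed
    qed
    moreover have "?v \<in> lists {0, 1}"
      using w(1) by (auto simp: sparse_words_def)
    ultimately show "?v \<in> words_of_length ?R (2 * g * Suc q)"
      using w(2) by (simp add: words_of_length_def sparse_words_def)
  qed
  ultimately have "card (?J \<times> words_of_length ?R ?m) \<le> num_words ?R (2 * g * Suc q)"
    by (rule card_inj_on_le[OF _ _ finite_sparse_words])
  moreover have "card ?J = g + 1" by simp
  ultimately have "(g + 1) * num_words ?R ?m \<le> num_words ?R (2 * g * Suc q)"
    by (simp only: card_cartesian_product)
  then show ?case
    using mult_le_mono2[OF Suc, of "g + 1"] by simp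
qed

lemma card_short_sparse_words: "card (short_sparse_words g n) = (\<Sum>m\<le>n. num_words (sparse_words g) m)"
  using language_growth_eq_sum[OF _ sparse_words_subset, of g n]
  by (simp add: language_growth_def short_sparse_words_def)

lemma card_short_sparse_words_upper:
  "card (short_sparse_words g (q * g)) \<le> (q * g + 1) * (g + 1) ^ q"
proof -
  have "card (short_sparse_words g (q * g)) \<le> (\<Sum>m\<le>q * g. (g + 1) ^ q)"
    unfolding card_short_sparse_words
    by (rule sum_mono, rule le_trans[OF num_sparse_words_mono num_sparse_words_upper]) simp
  then show ?thesis by simp
qed

section \<open>Realizing superlinear model functions\<close>

lemma factor_closed_Union: "(\<And>L. L \<in> \<L> \<Longrightarrow> factor_closed L) \<Longrightarrow> factor_closed (\<Union>\<L>)"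
  unfolding factor_closed_def by blast

text \<open>Repeatedly add a shortest missing word: its proper factors are shorter and lie in
  \<open>P \<union> Q\<close>, so they are already present.\<close>

lemma factor_closed_interpolation:
  assumes P: "finite P" "factor_closed P" and Q: "finite Q" "factor_closed Q"
    and s: "card P \<le> s" "s \<le> card (P \<union> Q)"
  shows "\<exists>T. factor_closed T \<and> P \<subseteq> T \<and> T \<subseteq> P \<union> Q \<and> card T = s"
  using s
proof (induction s rule: dec_induct)
  case base
  then show ?case using P by blast
next
  case (step s)
  then obtain T where T: "factor_closed T" "P \<subseteq> T" "T \<subseteq> P \<union> Q" "card T = s" by auto
  then have "T \<noteq> P \<union> Q"
    using step.prems by auto
  with T(3) obtain w0 where "w0 \<in> P \<union> Q - T" by blast
  then obtain w where w: "w \<in> P \<union> Q - T" "\<And>v. v \<in> P \<union> Q - T \<Longrightarrow> length w \<le> length v"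
    using ex_has_least_nat[of "\<lambda>w. w \<in> P \<union> Q - T" w0 length] by blast
  have "factor_closed (insert w T)"
    unfolding factor_closed_def
  proof (intro ballI allI impI)
    fix v u assume v: "v \<in> insert w T" and u: "sublist u v"
    show "u \<in> insert w T"
    proof (cases "v = w \<and> u \<noteq> w")
      case True
      then have "u \<in> P \<union> Q"
        using w(1) u P(2) Q(2) by (auto dest: factor_closedD)
      moreover have "length u < length w"
        using True u by (auto simp: sublist_def)
      ultimately have "u \<in> T"
        using w(2)[of u] by fastforce
      then show ?thesis by simp
    qed (use v u T(1) factor_closedD in blast)
  qed
  moreover have "finite T"
    using T(3) P(1) Q(1) finite_subset by blast
  then have "card (insert w T) = Suc s"
    using w(1) T(4) by simp
  ultimately show ?case
    using T w(1) by blast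
qed

section \<open>Iterating property (ii) and choosing the level of each stage\<close>

locale superlinear_growth =
  fixes F :: "nat \<Rightarrow> nat"
  assumes model: "superlinear_model F"
begin

text \<open>By monotonicity the truncated subtraction agrees with \<open>discrete_deriv\<close> for
  \<open>n \<ge> 1\<close>; at \<open>0\<close> it gives \<open>0\<close> instead of
  \<open>F 0\<close>.\<close>

definition deriv :: "nat \<Rightarrow> nat" where
  "deriv n = F n - F (n - 1)"

lemma F_mono: "m \<le> n \<Longrightarrow> F m \<le> F n"
  using model by (auto simp: superlinear_model_def mono_def)

lemma discrete_deriv_eq: "1 \<le> n \<Longrightarrow> discrete_deriv F n = int (deriv n)"
  using F_mono[of "n - 1" n] by (simp add: discrete_deriv_def deriv_def of_nat_diff)

lemma F_ge1: "1 \<le> F n"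
proof -
  have "discrete_deriv F 0 \<ge> 1"
    using model unfolding superlinear_model_def by (metis add.left_neutral of_nat_0)
  then show ?thesis
    using F_mono[of 0 n] by (simp add: discrete_deriv_def)
qed

lemma deriv_ge: "1 \<le> n \<Longrightarrow> n + 1 \<le> deriv n"
proof -
  assume n: "1 \<le> n"
  have "int n + 1 \<le> discrete_deriv F n"
    using model by (simp add: superlinear_model_def)
  then show ?thesis
    using discrete_deriv_eq[OF n] by linarith
qed

lemma deriv_le_square:
  assumes "1 \<le> n" "n \<le> m" "m \<le> 2 * n"
  shows "deriv m \<le> (deriv n)\<^sup>2"
proof -
  have "discrete_deriv F m \<le> (discrete_deriv F n)\<^sup>2"
    using model assms by (auto simp: superlinear_model_def)
  then show ?thesis
    using discrete_deriv_eq[of n] discrete_deriv_eq[of m] assms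
    by (simp flip: of_nat_power)
qed

text \<open>Property (ii) is applied once per doubling, and each application squares the
  bound.\<close>

lemma deriv_le_power: "1 \<le> n \<Longrightarrow> n \<le> m \<Longrightarrow> m \<le> 2 ^ s * n \<Longrightarrow> deriv m \<le> deriv n ^ 2 ^ s"
proof (induction s arbitrary: m)
  case (Suc s)
  have ge1: "1 \<le> deriv n"
    using deriv_ge[OF Suc.prems(1)] by simp
  show ?case
  proof (cases "m \<le> 2 ^ s * n")
    case True
    then have "deriv m \<le> deriv n ^ 2 ^ s"
      using Suc by blast
    also have "\<dots> \<le> deriv n ^ 2 ^ Suc s"
      using ge1 by (intro power_increasing) auto
    finally show ?thesis .
  next
    case False
    \<comment> \<open>Half of \<open>m\<close>, rounded up, so that \<open>m\<close> lies in
      \<open>{h..2 * h}\<close>. If \<open>h\<close> falls below \<open>n\<close>, then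
      \<open>m \<le> 2 * n\<close> and (ii) applies to \<open>n\<close> itself.\<close>
    define h where "h = (m + 1) div 2"
    have "n \<le> 2 ^ s * n" by simp
    then have h: "h \<le> m" "m \<le> 2 * h" "h \<le> 2 ^ s * n" "1 \<le> h"
      using False Suc.prems by (auto simp: h_def)
    show ?thesis
    proof (cases "n \<le> h")
      case True
      have "deriv m \<le> (deriv h)\<^sup>2"
        using h by (intro deriv_le_square)
      also have "\<dots> \<le> (deriv n ^ 2 ^ s)\<^sup>2"
        using Suc h True by (intro power_mono) auto
      also have "\<dots> = deriv n ^ 2 ^ Suc s"
        by (simp add: power_mult[symmetric] mult.commute)
      finally show ?thesis .
    next
      case False
      then have "deriv m \<le> (deriv n) ^ 2 ^ 1"
        using deriv_le_square[of n m] Suc.prems h by simp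
      also have "\<dots> \<le> deriv n ^ 2 ^ Suc s"
        using ge1 by (intro power_increasing power_increasing[of 1 "Suc s" 2]) auto
      finally show ?thesis .
    qed
  qed
qed simp

lemma F_eq_sum: "m \<le> n \<Longrightarrow> F n = F m + (\<Sum>i\<in>{m<..n}. deriv i)"
proof (induction n rule: dec_induct)
  case (step n)
  have "{m<..Suc n} = insert (Suc n) {m<..n}"
    using step by auto
  then show ?case
    using step F_mono[of n "Suc n"] by (simp add: deriv_def)
qed simp

text \<open>A level \<open>m\<close> is admissible for \<open>k\<close> if the words of \<open>sparse_words (2 ^ m)\<close> may be added at stage
  \<open>k\<close> without producing too many words of length \<open>2 ^ i\<close> for \<open>i < k\<close>.\<close>

definition admissible :: "nat \<Rightarrow> nat \<Rightarrow> bool" where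
  "admissible m k \<longleftrightarrow> (\<forall>i<k. card (short_sparse_words (2 ^ m) (2 ^ i)) + F (2 ^ i) \<le> F (2 ^ Suc i))"

definition level :: "nat \<Rightarrow> nat" where
  "level k = (LEAST m. admissible m k)"

text \<open>Words of length at most \<open>2 ^ i \<le> 2 ^ m\<close> contain at most one
  \<open>1\<close>, so their number is quadratic in \<open>2 ^ i\<close>, and property (i) provides
  that much room between \<open>2 ^ i\<close> and \<open>2 ^ Suc i\<close>. Hence \<open>k\<close>
  is admissible for \<open>k\<close>, and \<open>m\<close> can fail only at some
  \<open>i > m\<close>.\<close>

lemma admissible_small:
  assumes "i \<le> m"
  shows "card (short_sparse_words (2 ^ m) (2 ^ i)) + F (2 ^ i) \<le> F (2 ^ Suc i)"
proof -
  let ?N = "2 ^ i :: nat"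
  have N: "?N \<le> 2 ^ m" "1 \<le> ?N" using assms by simp_all
  have "j \<le> Suc (2 ^ m)" if "j \<le> ?N" for j
    using that N(1) by linarith
  then have "card (short_sparse_words (2 ^ m) ?N) \<le> (\<Sum>j\<le>?N. Suc j)"
    unfolding card_short_sparse_words by (intro sum_mono num_sparse_words_le) simp
  \<comment> \<open>The empty word is split off; it fits into the surplus \<open>?N * ?N\<close>
    that arises when the summation index is shifted by \<open>?N\<close>.\<close>
  also have "\<dots> = 1 + (\<Sum>j\<in>{0<..?N}. Suc j)"
  proof -
    have "{..?N} = insert 0 {0<..?N}" by auto
    then show ?thesis by simp
  qed
  also have "\<dots> \<le> ?N * ?N + (\<Sum>j\<in>{0<..?N}. Suc j)"
    using N by simp
  also have "\<dots> = (\<Sum>j\<in>{0<..?N}. ?N + Suc j)"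
    using sum.distrib[of "\<lambda>_. ?N" Suc "{0<..?N}"] by simp
  also have "\<dots> = (\<Sum>j\<in>{?N<..2 * ?N}. j + 1)"
    by (rule sum.reindex_bij_witness[of _ "\<lambda>j. j - ?N" "\<lambda>j. ?N + j"]) auto
  also have "\<dots> \<le> (\<Sum>j\<in>{?N<..2 * ?N}. deriv j)"
    by (rule sum_mono, rule deriv_ge) auto
  finally show ?thesis
    using F_eq_sum[of ?N "2 * ?N"] by simp
qed

lemma admissible_level: "admissible (level k) k"
  unfolding level_def
  by (rule LeastI[of _ k]) (use admissible_small in \<open>auto simp: admissible_def\<close>)

lemma level_le: "level k \<le> k"
  unfolding level_def
  by (rule Least_le) (use admissible_small in \<open>auto simp: admissible_def\<close>)

text \<open>Since \<open>M\<close> is not admissible, \<open>F (2 * N) - F N\<close> is smaller than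
  \<open>card (short_sparse_words (2 ^ M) N)\<close> for some \<open>N = 2 ^ i\<close>, so the
  derivative is small at some point of \<open>{N<..2 * N}\<close>. Property (ii) carries this bound
  on to \<open>2 ^ k\<close>, multiplying the exponent by \<open>2 ^ (k - i)\<close>.\<close>

lemma block_upper:
  assumes M: "level k = Suc M"
  shows "F (2 ^ k) - F (2 ^ (k - 1)) \<le> (2 ^ M + 1) ^ 2 ^ (k - M + 2)"
proof -
  have "\<not> admissible M k"
    using not_less_Least[of M "\<lambda>m. admissible m k"] M by (simp add: level_def)
  then obtain i where i: "i < k" "F (2 ^ Suc i) < card (short_sparse_words (2 ^ M) (2 ^ i)) + F (2 ^ i)"
    by (auto simp: admissible_def not_le)
  have Mi: "M < i"
    using admissible_small[of i M] i(2) by (meson leI not_less)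
  define N h where "N = (2 ^ i :: nat)" and "h = (2 ^ M :: nat)"
  have h: "1 \<le> h" by (simp add: h_def)
  have N: "1 \<le> N" "2 ^ (i - M) * h = N" "2 ^ Suc i = 2 * N"
    using Mi by (simp_all add: N_def h_def flip: power_add)
  have "F (2 * N) < card (short_sparse_words h N) + F N"
    using i(2) N(3) by (simp add: N_def h_def)
  moreover have "card (short_sparse_words h N) \<le> (N + 1) * (h + 1) ^ 2 ^ (i - M)"
    using card_short_sparse_words_upper[of h "2 ^ (i - M)"] N(2) by simp
  ultimately have upper: "(\<Sum>j\<in>{N<..2 * N}. deriv j) < (N + 1) * (h + 1) ^ 2 ^ (i - M)"
    using F_eq_sum[of N "2 * N"] by simp
  \<comment> \<open>If all derivatives exceeded this bound, their sum would contradict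
    \<open>upper\<close>: squaring \<open>(h + 1) ^ 2 ^ (i - M)\<close> outweighs the factor
    \<open>N + 1\<close>.\<close>
  have "\<exists>n\<in>{N<..2 * N}. deriv n \<le> (h + 1) ^ 2 ^ (i - M + 1)"
  proof (rule ccontr)
    assume neg: "\<not> ?thesis"
    have "(\<Sum>j\<in>{N<..2 * N}. (h + 1) ^ 2 ^ (i - M + 1)) \<le> (\<Sum>j\<in>{N<..2 * N}. deriv j)"
      by (rule sum_mono) (use neg in \<open>meson nat_le_linear\<close>)
    then have "N * (h + 1) ^ 2 ^ (i - M + 1) \<le> (\<Sum>j\<in>{N<..2 * N}. deriv j)"
      by simp
    moreover have "(N + 1) * (h + 1) ^ 2 ^ (i - M) \<le> N * (h + 1) ^ 2 ^ (i - M + 1)"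
    proof -
      let ?a = "(h + 1) ^ 2 ^ (i - M)"
      have "h + 1 \<le> ?a"
        using power_increasing[of 1 "2 ^ (i - M)" "h + 1"] by simp
      then have "2 \<le> ?a" using h by simp
      have "(N + 1) * ?a \<le> (N * 2) * ?a" using N(1) by (intro mult_le_mono1) simp
      also have "\<dots> \<le> (N * ?a) * ?a" using \<open>2 \<le> ?a\<close> by (intro mult_le_mono) auto
      also have "\<dots> = N * (h + 1) ^ 2 ^ (i - M + 1)"
        by (simp add: power_add[symmetric] mult.assoc mult_2 del: power_Suc)
           (simp add: power_add mult_2)
      finally show ?thesis .
    qed
    ultimately show False using upper by simp
  qed
  then obtain n where n: "N < n" "n \<le> 2 * N" "deriv n \<le> (h + 1) ^ 2 ^ (i - M + 1)" by auto
  define P where "P = (2 ^ (k - M) :: nat)"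
  \<comment> \<open>Together with \<open>2 ^ k = P * h\<close> this absorbs the number of summands
    of the block into a power of \<open>h + 1\<close>.\<close>
  have bernoulli: "q * h \<le> (h + 1) ^ q" for q
  proof (induction q)
    case (Suc q)
    have "Suc q * h \<le> h * (h + 1) ^ q + (h + 1) ^ q"
      using Suc by (simp add: add_mono)
    then show ?case by (simp add: algebra_simps)
  qed simp
  have pow_k: "(2::nat) ^ k \<le> (h + 1) ^ P"
  proof -
    have "2 ^ k = P * h"
      using Mi i(1) by (simp add: P_def h_def flip: power_add)
    also have "\<dots> \<le> (h + 1) ^ P"
      by (rule bernoulli)
    finally show ?thesis .
  qed
  have "F (2 ^ k) - F (2 ^ (k - 1)) \<le> 2 ^ k * (h + 1) ^ (2 * P)"
  \<comment> \<open>For \<open>k = Suc i\<close> the block is the one containing \<open>n\<close>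
    and may have points before \<open>n\<close>, so \<open>upper\<close> is used directly. Otherwise
    the block lies beyond \<open>n\<close> and \<open>deriv_le_power\<close> applies.\<close>
  proof (cases "k = Suc i")
    case True
    have "F (2 ^ k) - F (2 ^ (k - 1)) = (\<Sum>j\<in>{N<..2 * N}. deriv j)"
      using F_eq_sum[of N "2 * N"] True by (simp add: N_def)
    also have "\<dots> \<le> (N + 1) * (h + 1) ^ 2 ^ (i - M)"
      using upper by simp
    also have "\<dots> \<le> 2 ^ k * (h + 1) ^ (2 * P)"
    proof (rule mult_le_mono)
      show "N + 1 \<le> 2 ^ k" using True N by (simp add: N_def)
      have "2 ^ (i - M) \<le> 2 * P"
        unfolding P_def power_Suc[symmetric] by (rule power_increasing) (use True in auto)
      then show "(h + 1) ^ 2 ^ (i - M) \<le> (h + 1) ^ (2 * P)"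
        by (intro power_increasing) auto
    qed
    finally show ?thesis .
  next
    case False
    then have ki: "Suc i \<le> k - 1" "Suc (k - 1) = k" using i(1) by auto
    have le: "2 * N \<le> 2 ^ (k - 1)"
      unfolding N_def power_Suc[symmetric] by (rule power_increasing) (use ki in auto)
    have "F (2 ^ k) - F (2 ^ (k - 1)) = (\<Sum>j\<in>{2 ^ (k - 1)<..2 ^ k}. deriv j)"
      using F_eq_sum[of "2 ^ (k - 1)" "2 ^ k"] by (simp add: power_increasing)
    also have "\<dots> \<le> (\<Sum>j\<in>{2 ^ (k - 1)<..2 ^ k::nat}. (h + 1) ^ (2 * P))"
    proof (rule sum_mono)
      fix j assume j: "j \<in> {2 ^ (k - 1)<..2 ^ k::nat}"
      have "2 ^ k = 2 ^ (k - i) * N"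
        using i(1) by (simp add: N_def flip: power_add)
      also have "\<dots> \<le> 2 ^ (k - i) * n"
        using n(1) by simp
      finally have "deriv j \<le> deriv n ^ 2 ^ (k - i)"
        using j n N le by (intro deriv_le_power) auto
      also have "\<dots> \<le> ((h + 1) ^ 2 ^ (i - M + 1)) ^ 2 ^ (k - i)"
        using n(3) by (intro power_mono) auto
      also have "\<dots> = (h + 1) ^ 2 ^ (i - M + 1 + (k - i))"
        by (simp only: power_mult[symmetric] power_add[symmetric])
      also have "i - M + 1 + (k - i) = Suc (k - M)"
        using Mi i(1) by simp
      finally show "deriv j \<le> (h + 1) ^ (2 * P)"
        by (simp add: P_def)
    qed
    also have "\<dots> \<le> 2 ^ k * (h + 1) ^ (2 * P)"
      by simp
    finally show ?thesis .
  qed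
  also have "\<dots> \<le> (h + 1) ^ P * (h + 1) ^ (2 * P)"
    using pow_k by (intro mult_le_mono1)
  also have "\<dots> = (h + 1) ^ (P + 2 * P)"
    by (rule power_add[symmetric])
  also have "\<dots> \<le> (h + 1) ^ 2 ^ (k - M + 2)"
    by (rule power_increasing) (simp_all add: P_def power_add)
  finally show ?thesis by (simp add: h_def)
qed

text \<open>Stage \<open>k\<close> will use words of length at most \<open>2 ^ (k + shift)\<close>. The summand \<open>4\<close> pays for the
  exponent in \<open>block_upper\<close>, the summand \<open>F 1\<close> for the case \<open>level k = 0\<close>, where \<open>deriv 1\<close> may be large.\<close>

definition shift :: nat where
  "shift = F 1 + 4"

lemma shift_bound: "F 1 + 1 \<le> 2 ^ (shift - 1)"
proof -
  have "shift - 1 < 2 ^ (shift - 1)" by (rule less_exp)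
  moreover have "F 1 + 1 \<le> shift - 1" by (simp add: shift_def)
  ultimately show ?thesis by linarith
qed

lemma sparse_words_level_lower:
  "(2 ^ level k + 1) ^ 2 ^ (k + shift - 1 - level k) \<le> num_words (sparse_words (2 ^ level k)) (2 ^ (k + shift))"
proof -
  \<comment> \<open>The \<open>- 1\<close> compensates the factor \<open>2\<close> in the block
    length \<open>2 * g\<close> of \<open>num_sparse_words_lower\<close>.\<close>
  have "2 * 2 ^ level k * 2 ^ (k + shift - 1 - level k) = (2::nat) ^ (k + shift)"
    using level_le[of k] by (simp add: shift_def flip: power_add power_Suc)
  then show ?thesis
    using num_sparse_words_lower[of "2 ^ level k" "2 ^ (k + shift - 1 - level k)"] by simp
qed

lemma level_0: "level 0 = 0"
  using level_le[of 0] by simp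

lemma enough_words_0: "F 1 \<le> num_words (sparse_words (2 ^ level 0)) (2 ^ shift)"
proof -
  have "F 1 < 2 ^ F 1" by (rule less_exp)
  also have "\<dots> \<le> (2::nat) ^ 2 ^ (shift - 1)"
    by (rule power_increasing) (use shift_bound in auto)
  also have "\<dots> \<le> num_words (sparse_words (2 ^ level 0)) (2 ^ shift)"
    using sparse_words_level_lower[of 0] by (simp add: level_0 numeral_2_eq_2)
  finally show ?thesis by simp
qed

text \<open>At positive level \<open>block_upper\<close> bounds the demand. At level
  \<open>0\<close> no smaller level has failed; there \<open>deriv 1\<close> bounds the demand
  through (ii), and \<open>shift\<close> is large in terms of \<open>F 1\<close>.\<close>

lemma enough_words:
  assumes k: "1 \<le> k"
  shows "F (2 ^ k) - F (2 ^ (k - 1)) \<le> num_words (sparse_words (2 ^ level k)) (2 ^ (k + shift))"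
proof (cases "level k")
  case 0
  have "F (2 ^ k) - F (2 ^ (k - 1)) = (\<Sum>j\<in>{2 ^ (k - 1)<..2 ^ k}. deriv j)"
    using F_eq_sum[of "2 ^ (k - 1)" "2 ^ k"] by (simp add: power_increasing)
  also have "\<dots> \<le> (\<Sum>j\<in>{2 ^ (k - 1)<..2 ^ k::nat}. deriv 1 ^ 2 ^ k)"
    by (rule sum_mono, rule deriv_le_power) auto
  also have "\<dots> \<le> 2 ^ 2 ^ k * deriv 1 ^ 2 ^ k"
  proof -
    have "(2::nat) ^ k - 2 ^ (k - 1) \<le> 2 ^ 2 ^ k"
      by (rule le_trans[OF diff_le_self less_imp_le_nat[OF less_exp]])
    then show ?thesis by simp
  qed
  also have "\<dots> = (2 * deriv 1) ^ 2 ^ k"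
    by (simp add: power_mult_distrib)
  also have "\<dots> \<le> (2 ^ 2 ^ (shift - 1)) ^ 2 ^ k"
  proof (rule power_mono)
    have "2 * deriv 1 \<le> 2 * 2 ^ F 1"
      unfolding deriv_def
      by (intro mult_le_mono2 le_trans[OF diff_le_self less_imp_le_nat[OF less_exp]])
    also have "\<dots> = 2 ^ Suc (F 1)" by simp
    also have "\<dots> \<le> 2 ^ 2 ^ (shift - 1)"
      by (rule power_increasing) (use shift_bound in auto)
    finally show "2 * deriv 1 \<le> 2 ^ 2 ^ (shift - 1)" .
  qed simp
  also have "\<dots> = 2 ^ 2 ^ (k + shift - 1)"
    by (simp add: shift_def power_add mult.commute flip: power_mult)
  also have "\<dots> \<le> num_words (sparse_words (2 ^ level k)) (2 ^ (k + shift))"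
    using sparse_words_level_lower[of k] 0 by (simp add: numeral_2_eq_2)
  finally show ?thesis .
next
  case (Suc M)
  have "F (2 ^ k) - F (2 ^ (k - 1)) \<le> (2 ^ M + 1) ^ 2 ^ (k - M + 2)"
    by (rule block_upper[OF Suc])
  also have "\<dots> \<le> (2 ^ level k + 1) ^ 2 ^ (k - M + 2)"
    using Suc by (intro power_mono) auto
  \<comment> \<open>As \<open>shift = F 1 + 4\<close>, the right inner exponent equals
    \<open>k - M + 2 + F 1\<close>.\<close>
  also have "\<dots> \<le> (2 ^ level k + 1) ^ 2 ^ (k + shift - 1 - level k)"
    using Suc level_le[of k] by (intro power_increasing) (auto simp: shift_def)
  also have "\<dots> \<le> num_words (sparse_words (2 ^ level k)) (2 ^ (k + shift))"
    by (rule sparse_words_level_lower)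
  finally show ?thesis .
qed

section \<open>Building the language stage by stage\<close>

definition good_stage :: "nat \<Rightarrow> nat list set \<Rightarrow> bool" where
  "good_stage k T \<longleftrightarrow> factor_closed T \<and> finite T \<and> card T = F (2 ^ k) \<and> T \<subseteq> lists {0, 1} \<and>
     (\<forall>w\<in>T. length w \<le> 2 ^ (k + shift))"

text \<open>The sparse words of length exactly \<open>2 ^ (k + shift)\<close> are longer than all
  words of \<open>P\<close>, hence new, and there are enough of them for
  \<open>factor_closed_interpolation\<close> to reach \<open>F (2 ^ k)\<close>.\<close>

lemma good_stage_extend:
  assumes P: "finite P" "factor_closed P" "P \<subseteq> lists {0, 1}" "\<And>w. w \<in> P \<Longrightarrow> length w < 2 ^ (k + shift)"
    and card: "card P \<le> F (2 ^ k)"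
      "F (2 ^ k) - card P \<le> num_words (sparse_words (2 ^ level k)) (2 ^ (k + shift))"
  shows "\<exists>T. good_stage k T \<and> P \<subseteq> T \<and> T \<subseteq> P \<union> sparse_words (2 ^ level k)"
proof -
  let ?R = "sparse_words (2 ^ level k)"
  let ?Q = "short_sparse_words (2 ^ level k) (2 ^ (k + shift))"
  let ?W = "words_of_length ?R (2 ^ (k + shift))"
  have "P \<inter> ?W = {}"
    using P(4) by (fastforce simp: words_of_length_def)
  then have "card P + card ?W = card (P \<union> ?W)"
    by (rule card_Un_disjoint[OF P(1) finite_sparse_words, symmetric])
  also have "\<dots> \<le> card (P \<union> ?Q)"
    by (rule card_mono) (use P finite_short_sparse_words in
        \<open>auto simp: words_of_length_def short_sparse_words_def\<close>)
  finally have "F (2 ^ k) \<le> card (P \<union> ?Q)"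
    using card by simp
  then obtain T where T: "factor_closed T" "P \<subseteq> T" "T \<subseteq> P \<union> ?Q" "card T = F (2 ^ k)"
    using factor_closed_interpolation[OF P(1,2) finite_short_sparse_words factor_closed_short_sparse_words card(1)]
    by blast
  have "finite T"
    using T(3) P(1) finite_short_sparse_words finite_subset by blast
  moreover have "T \<subseteq> lists {0, 1}"
    using T(3) P(3) sparse_words_subset unfolding short_sparse_words_def by blast
  moreover have "length w \<le> 2 ^ (k + shift)" if "w \<in> T" for w
    using that T(3) P(4)[of w] by (auto simp: short_sparse_words_def)
  moreover have "T \<subseteq> P \<union> ?R"
    using T(3) by (auto simp: short_sparse_words_def)
  ultimately show ?thesis
    using T unfolding good_stage_def by blast
qed

lemma stages_exist:
  "\<exists>T. \<forall>k. good_stage k (T k) \<and> T k \<subseteq> T (Suc k) \<and> T (Suc k) \<subseteq> T k \<union> sparse_words (2 ^ level (Suc k))"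
proof -
  have "\<exists>T. \<forall>k. good_stage k (T k) \<and> (T k \<subseteq> T (Suc k) \<and> T (Suc k) \<subseteq> T k \<union> sparse_words (2 ^ level (Suc k)))"
  proof (rule dependent_nat_choice)
    show "\<exists>T. good_stage 0 T"
      using good_stage_extend[of "{}" 0] enough_words_0 by (auto simp: factor_closed_def)
  next
    fix T k assume T: "good_stage k T"
    have "length w < 2 ^ (Suc k + shift)" if "w \<in> T" for w
    proof -
      have "length w \<le> 2 ^ (k + shift)"
        using T that by (simp add: good_stage_def)
      also have "\<dots> < 2 ^ (Suc k + shift)"
        by (rule power_strict_increasing) auto
      finally show ?thesis .
    qed
    then show "\<exists>T'. good_stage (Suc k) T' \<and> T \<subseteq> T' \<and> T' \<subseteq> T \<union> sparse_words (2 ^ level (Suc k))"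
      using T enough_words[of "Suc k"] F_mono[of "2 ^ k" "2 ^ Suc k"]
      by (intro good_stage_extend) (auto simp: good_stage_def)
  qed
  then show ?thesis by blast
qed

theorem superlinear_language:
  "\<exists>L. factor_closed L \<and> L \<noteq> {} \<and> L \<subseteq> lists {0, 1 :: nat} \<and> growth_equiv F (language_growth L)"
proof -
  obtain T where T: "\<And>k. good_stage k (T k)" "\<And>k. T k \<subseteq> T (Suc k)"
    "\<And>k. T (Suc k) \<subseteq> T k \<union> sparse_words (2 ^ level (Suc k))"
    using stages_exist by blast
  define L where "L = (\<Union>k. T k)"
  have T_mono: "T j \<subseteq> T k" if "j \<le> k" for j k
    using lift_Suc_mono_le[of T, OF T(2) that] .
  have fin_T: "finite (T k)" and card_T: "card (T k) = F (2 ^ k)" for k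
    using T(1) by (auto simp: good_stage_def)
  have L: "factor_closed L" "L \<subseteq> lists {0, 1}"
    using T(1) unfolding L_def good_stage_def by (blast intro!: factor_closed_Union)+
  have fin_L: "finite {w \<in> L. length w \<le> n}" for n
    using finite_bounded_words[OF _ L(2)] by simp
  have "T 0 \<noteq> {}"
    using card_T[of 0] F_ge1[of 1] by auto
  then have "L \<noteq> {}" by (auto simp: L_def)
  have lower: "F (2 ^ k) \<le> language_growth L (2 ^ (k + shift))" for k
  proof -
    have "T k \<subseteq> {w \<in> L. length w \<le> 2 ^ (k + shift)}"
      using T(1)[of k] by (auto simp: L_def good_stage_def)
    then show ?thesis
      unfolding language_growth_def card_T[symmetric] by (rule card_mono[OF fin_L])
  qed
  have upper: "language_growth L (2 ^ i) \<le> F (2 ^ Suc i)" for i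
  proof -
    \<comment> \<open>The least level used after stage \<open>i\<close>. All words added later lie
      in \<open>sparse_words (2 ^ m)\<close>, and since \<open>m = level k\<close> for some
      \<open>k > i\<close>, admissibility bounds the number of short ones among them.\<close>
    define m where "m = (LEAST m. m \<in> level ` {i<..})"
    have "m \<in> level ` {i<..}"
      unfolding m_def by (rule LeastI[of _ "level (Suc i)"]) auto
    then obtain k where k: "i < k" "m = level k" by auto
    have m_le: "m \<le> level j" if "i < j" for j
      unfolding m_def using that by (intro Least_le) auto
    have "T (i + j) \<subseteq> T i \<union> sparse_words (2 ^ m)" for j
    proof (induction j)
      case (Suc j)
      have "sparse_words (2 ^ level (Suc (i + j))) \<subseteq> sparse_words (2 ^ m)"
        by (rule sparse_words_antimono) (simp add: m_le)
      then show ?case using T(3)[of "i + j"] Suc by auto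
    qed simp
    then have "T j \<subseteq> T i \<union> sparse_words (2 ^ m)" for j
      using T_mono[of j i] by (metis le_add_diff_inverse le_supI1 nat_le_linear)
    then have "{w \<in> L. length w \<le> 2 ^ i} \<subseteq> T i \<union> short_sparse_words (2 ^ m) (2 ^ i)"
      unfolding L_def short_sparse_words_def by blast
    then have "language_growth L (2 ^ i) \<le> card (T i \<union> short_sparse_words (2 ^ m) (2 ^ i))"
      unfolding language_growth_def by (rule card_mono[rotated]) (simp add: fin_T finite_short_sparse_words)
    also have "\<dots> \<le> F (2 ^ i) + card (short_sparse_words (2 ^ m) (2 ^ i))"
      using card_Un_le[of "T i"] card_T by metis
    also have "\<dots> \<le> F (2 ^ Suc i)"
      using admissible_level[of k] k unfolding admissible_def by (metis add.commute)
    finally show ?thesis .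
  qed
  have mono: "language_growth L m \<le> language_growth L n" if "m \<le> n" for m n
    by (rule language_growth_mono[OF _ L(2) that]) simp
  have dyadic: "\<exists>i. 2 ^ i \<le> n \<and> n \<le> 2 ^ Suc i" if "1 \<le> n" for n :: nat
    using ex_power_ivl1[of 2 n] that by auto
  have "growth_equiv F (language_growth L)"
  \<comment> \<open>One doubling in each constant rounds \<open>n\<close> up to a power of two; the
    rest comes from \<open>lower\<close> and \<open>upper\<close>.\<close>
  proof (rule growth_equivI[where C = "2 ^ Suc shift" and D = 4])
    fix n :: nat assume n: "1 \<le> n"
    obtain i where i: "2 ^ i \<le> n" "n \<le> 2 ^ Suc i"
      using dyadic[OF n] by blast
    have "F n \<le> language_growth L (2 ^ (Suc i + shift))"
      using F_mono[OF i(2)] lower[of "Suc i"] by simp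
    also have "\<dots> \<le> language_growth L (2 ^ Suc shift * n)"
      using i(1) by (intro mono) (simp add: power_add)
    finally show "F n \<le> language_growth L (2 ^ Suc shift * n)" .
    have "language_growth L n \<le> F (2 ^ Suc (Suc i))"
      using mono[OF i(2)] upper[of "Suc i"] by simp
    also have "\<dots> \<le> F (4 * n)"
      using i(1) by (intro F_mono) simp
    finally show "language_growth L n \<le> F (4 * n)" .
    have "language_growth L 0 = 1"
      using words_of_length_0[OF L(1) \<open>L \<noteq> {}\<close>] by (simp add: language_growth_eq_sum[OF _ L(2)])
    then show "1 \<le> language_growth L n"
      using mono[of 0 n] by simp
  qed (auto intro: F_mono mono F_ge1[simplified])
  with L \<open>L \<noteq> {}\<close> show ?thesis by blast
qed

end

section \<open>Normal words\<close>

lemma factor_closedI: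
  assumes left: "\<And>a u. a # u \<in> L \<Longrightarrow> u \<in> L" and right: "\<And>a u. u @ [a] \<in> L \<Longrightarrow> u \<in> L"
  shows "factor_closed L"
proof -
  have drop: "u \<in> L" if "p @ u \<in> L" for p u
    using that by (induction p) (auto dest: left)
  have "u \<in> L" if "u @ s \<in> L" for u s
    using that
  proof (induction s rule: rev_induct)
    case (snoc a s)
    then show ?case using right[of "u @ s" a] by simp
  qed simp
  then show ?thesis
    unfolding factor_closed_def sublist_def using drop by metis
qed

text \<open>Without a unit the empty word has no value; it is excluded wherever values
  matter.\<close>

fun word_prod :: "('a \<Rightarrow> 'a \<Rightarrow> 'a) \<Rightarrow> (nat \<Rightarrow> 'a) \<Rightarrow> nat list \<Rightarrow> 'a" where
  "word_prod mul f [] = undefined"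
| "word_prod mul f [i] = f i"
| "word_prod mul f (i # j # w) = mul (f i) (word_prod mul f (j # w))"

lemma word_prod_Cons: "w \<noteq> [] \<Longrightarrow> word_prod mul f (i # w) = mul (f i) (word_prod mul f w)"
  by (cases w) auto

definition nonempty_words :: "nat \<Rightarrow> nat \<Rightarrow> nat list set" where
  "nonempty_words r n = {w \<in> lists {..<r}. w \<noteq> [] \<and> length w \<le> n}"

definition smaller_words :: "nat \<Rightarrow> nat list \<Rightarrow> nat list set" where
  "smaller_words r w = {v \<in> lists {..<r}. v \<noteq> [] \<and> (v, w) \<in> lenlex less_than}"

lemma set_power_image:
  assumes "1 \<le> k"
  shows "set_power mul (f ` {..<r}) k = word_prod mul f ` {w \<in> lists {..<r}. length w = k}"
  using assms
proof (induction k rule: nat_induct_at_least)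
  case base
  have "{w \<in> lists {..<r}. length w = 1} = (\<lambda>i. [i]) ` {..<r}"
    by (auto simp: length_Suc_conv)
  then show ?case by (simp add: image_image)
next
  case (Suc k)
  have words: "{w \<in> lists {..<r}. length w = Suc k}
      = (\<lambda>(i, w). i # w) ` ({..<r} \<times> {w \<in> lists {..<r}. length w = k})"
    by (auto simp: length_Suc_conv image_iff)
  have "set_power mul (f ` {..<r}) (Suc k)
      = (\<lambda>(i, w). mul (f i) (word_prod mul f w)) ` ({..<r} \<times> {w \<in> lists {..<r}. length w = k})"
    using Suc by (cases k) fastforce+
  also have "\<dots> = word_prod mul f ` {w \<in> lists {..<r}. length w = Suc k}"
    unfolding words image_image
    by (rule image_cong) (use Suc.hyps in \<open>auto intro!: word_prod_Cons[symmetric]\<close>)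
  finally show ?case .
qed

lemma Union_set_power_image:
  "(\<Union>k\<in>{1..n}. set_power mul (f ` {..<r}) k) = word_prod mul f ` nonempty_words r n"
proof -
  have "(\<Union>k\<in>{1..n}. set_power mul (f ` {..<r}) k)
      = (\<Union>k\<in>{1..n}. word_prod mul f ` {w \<in> lists {..<r}. length w = k})"
    by (rule SUP_cong) (simp_all add: set_power_image)
  also have "\<dots> = word_prod mul f ` nonempty_words r n"
    unfolding image_UN[symmetric]
    by (rule arg_cong[of _ _ "image (word_prod mul f)"]) (auto simp: nonempty_words_def Suc_le_eq)
  finally show ?thesis .
qed

text \<open>The closure operator \<open>cl\<close> is the identity for semigroups and the linear span for algebras.\<close>

locale word_reduction = semigroup_on S mul
  for S :: "'a set" and mul :: "'a \<Rightarrow> 'a \<Rightarrow> 'a" +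
  fixes f :: "nat \<Rightarrow> 'a" and r :: nat and cl :: "'a set \<Rightarrow> 'a set"
  assumes letters: "i < r \<Longrightarrow> f i \<in> S"
    and cl_extensive: "B \<subseteq> cl B"
    and cl_least: "B \<subseteq> cl C \<Longrightarrow> cl B \<subseteq> cl C"
    and cl_left: "a \<in> S \<Longrightarrow> B \<subseteq> S \<Longrightarrow> x \<in> cl B \<Longrightarrow> mul a x \<in> cl (mul a ` B)"
    and cl_right: "a \<in> S \<Longrightarrow> B \<subseteq> S \<Longrightarrow> x \<in> cl B \<Longrightarrow> mul x a \<in> cl ((\<lambda>b. mul b a) ` B)"
begin

abbreviation val :: "nat list \<Rightarrow> 'a" where
  "val \<equiv> word_prod mul f"

text \<open>The normal words of Groebner basis theory. The empty word is added so that the language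
  is factor-closed.\<close>

definition normal_words :: "nat list set" where
  "normal_words = {w \<in> lists {..<r}. w = [] \<or> val w \<notin> cl (val ` smaller_words r w)}"

lemma normal_words_subset: "normal_words \<subseteq> lists {..<r}"
  by (auto simp: normal_words_def)

lemma cl_mono: "B \<subseteq> C \<Longrightarrow> cl B \<subseteq> cl C"
  by (meson cl_extensive cl_least order_trans)

lemma val_in: "w \<in> lists {..<r} \<Longrightarrow> w \<noteq> [] \<Longrightarrow> val w \<in> S"
proof (induction w)
  case (Cons i w)
  then show ?case
    by (cases "w = []") (simp_all add: word_prod_Cons letters mul_closed)
qed simp

lemma val_append_letter:
  "w \<in> lists {..<r} \<Longrightarrow> w \<noteq> [] \<Longrightarrow> i < r \<Longrightarrow> val (w @ [i]) = mul (val w) (f i)"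
proof (induction w)
  case (Cons j w)
  then show ?case
    by (cases "w = []") (simp_all add: word_prod_Cons mul_assoc letters val_in)
qed simp

lemma smaller_words_image_subset: "val ` smaller_words r w \<subseteq> S"
  by (auto simp: smaller_words_def intro: val_in)

text \<open>If \<open>u\<close> reduces to smaller words, then multiplying by a letter reduces
  \<open>a # u\<close> and \<open>u @ [a]\<close> to smaller words as well, because the
  length-lexicographic order is compatible with both multiplications.\<close>

lemma factor_closed_normal_words: "factor_closed normal_words"
proof (rule factor_closedI)
  fix a u assume "a # u \<in> normal_words"
  then have au: "a < r" "u \<in> lists {..<r}" "val (a # u) \<notin> cl (val ` smaller_words r (a # u))"
    by (auto simp: normal_words_def)
  show "u \<in> normal_words"
  proof (rule ccontr)
    assume "u \<notin> normal_words"
    then have u: "u \<noteq> []" "val u \<in> cl (val ` smaller_words r u)"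
      using au by (auto simp: normal_words_def)
    have "val (a # u) \<in> cl (mul (f a) ` val ` smaller_words r u)"
      using cl_left[OF letters[OF au(1)] smaller_words_image_subset u(2)] by (simp add: word_prod_Cons u(1))
    moreover have "mul (f a) ` val ` smaller_words r u \<subseteq> val ` smaller_words r (a # u)"
    proof (intro subsetI, elim imageE)
      fix x y v assume v: "v \<in> smaller_words r u" and x: "x = mul (f a) y" "y = val v"
      show "x \<in> val ` smaller_words r (a # u)"
        using v au(1) x lenlex_length[of v u less_than]
        by (intro image_eqI[of _ _ "a # v"]) (auto simp: smaller_words_def word_prod_Cons Cons_lenlex_iff)
    qed
    ultimately show False
      using au(3) subsetD[OF cl_mono] by blast
  qed
next
  fix a u assume "u @ [a] \<in> normal_words"
  then have au: "a < r" "u \<in> lists {..<r}" "val (u @ [a]) \<notin> cl (val ` smaller_words r (u @ [a]))"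
    by (auto simp: normal_words_def)
  show "u \<in> normal_words"
  proof (rule ccontr)
    assume "u \<notin> normal_words"
    then have u: "u \<noteq> []" "val u \<in> cl (val ` smaller_words r u)"
      using au by (auto simp: normal_words_def)
    have "val (u @ [a]) \<in> cl ((\<lambda>b. mul b (f a)) ` val ` smaller_words r u)"
      using cl_right[OF letters[OF au(1)] smaller_words_image_subset u(2)] val_append_letter[OF au(2) u(1) au(1)]
      by simp
    moreover have "(\<lambda>b. mul b (f a)) ` val ` smaller_words r u \<subseteq> val ` smaller_words r (u @ [a])"
    proof (intro subsetI, elim imageE)
      fix x y v assume v: "v \<in> smaller_words r u" and x: "x = mul y (f a)" "y = val v"
      show "x \<in> val ` smaller_words r (u @ [a])"
        using v au(1) x lenlex_append1[of v u less_than "[a]" "[a]"]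
        by (intro image_eqI[of _ _ "v @ [a]"]) (auto simp: smaller_words_def val_append_letter)
    qed
    ultimately show False
      using au(3) subsetD[OF cl_mono] by blast
  qed
qed

abbreviation short_normal_words :: "nat \<Rightarrow> nat list set" where
  "short_normal_words n \<equiv> normal_words \<inter> nonempty_words r n"

lemma finite_short_normal_words: "finite (short_normal_words n)"
  by (rule finite_subset[OF _ finite_bounded_words[of "{..<r}" "lists {..<r}" n]])
    (auto simp: nonempty_words_def)

lemma card_short_normal_words: "card (short_normal_words n) + 1 = language_growth normal_words n"
proof -
  have "{w \<in> normal_words. length w \<le> n} = insert [] (short_normal_words n)"
    by (auto simp: normal_words_def nonempty_words_def)
  moreover have "[] \<notin> short_normal_words n"
    by (simp add: nonempty_words_def)
  ultimately show ?thesis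
    using finite_short_normal_words by (simp add: language_growth_def)
qed

text \<open>Well-founded induction: a word that is not normal reduces to smaller words, which are
  not longer, so the bound \<open>n\<close> is kept.\<close>

lemma val_in_cl_normal:
  "w \<in> nonempty_words r n \<Longrightarrow> val w \<in> cl (val ` short_normal_words n)"
proof (induction w rule: wf_induct_rule[OF wf_lenlex[OF wf_less_than]])
  case (1 w)
  show ?case
  proof (cases "w \<in> normal_words")
    case True
    with 1(2) show ?thesis by (intro subsetD[OF cl_extensive] imageI IntI)
  next
    case False
    then have "val w \<in> cl (val ` smaller_words r w)"
      using 1(2) by (auto simp: normal_words_def nonempty_words_def)
    moreover have "val ` smaller_words r w \<subseteq> cl (val ` short_normal_words n)"
    proof (rule image_subsetI)
      fix v assume "v \<in> smaller_words r w"
      then have v: "v \<in> lists {..<r}" "v \<noteq> []" "(v, w) \<in> lenlex less_than"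
        by (auto simp: smaller_words_def)
      then have "v \<in> nonempty_words r n"
        using 1(2) lenlex_length[OF v(3)] by (auto simp: nonempty_words_def)
      with 1(1) v(3) show "val v \<in> cl (val ` short_normal_words n)" by blast
    qed
    ultimately show ?thesis
      by (rule subsetD[OF cl_least, rotated])
  qed
qed

lemma smaller_or_equal_words:
  assumes "v \<in> lists {..<r}" "w \<in> lists {..<r}" "v \<noteq> []" "w \<noteq> []" "v \<noteq> w"
  shows "v \<in> smaller_words r w \<or> w \<in> smaller_words r v"
proof -
  have "total (lenlex less_than)"
    by (rule total_lenlex) (auto simp: total_on_def)
  then show ?thesis
    using assms unfolding smaller_words_def total_on_def by blast
qed

lemma inj_on_val_normal: "inj_on val (normal_words - {[]})"
proof (rule inj_onI, rule ccontr)
  fix v w assume vw: "v \<in> normal_words - {[]}" "w \<in> normal_words - {[]}" "val v = val w" "v \<noteq> w"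
  then consider "v \<in> smaller_words r w" | "w \<in> smaller_words r v"
    using smaller_or_equal_words normal_words_subset by blast
  then show False
  proof cases
    case 1
    then have "val w \<in> cl (val ` smaller_words r w)"
      using vw(3) cl_extensive by (metis imageI subsetD)
    with vw show False by (auto simp: normal_words_def)
  next
    case 2
    then have "val v \<in> cl (val ` smaller_words r v)"
      using vw(3) cl_extensive by (metis imageI subsetD)
    with vw show False by (auto simp: normal_words_def)
  qed
qed

text \<open>Drives the proof of linear independence, where the largest word is removed
  first.\<close>

lemma largest_word:
  assumes "finite T" "T \<noteq> {}" "T \<subseteq> lists {..<r} - {[]}"
  shows "\<exists>w\<in>T. T - {w} \<subseteq> smaller_words r w"
proof -
  have asym: "asym (lenlex less_than)" and trans: "trans (lenlex less_than)"
    by (simp_all add: asym_lenlex[OF asym_less_than] lenlex_transI)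
  obtain w where w: "w \<in> T" "\<forall>v\<in>T. v \<noteq> w \<longrightarrow> (w, v) \<notin> lenlex less_than"
  proof -
    have "asymp_on T (\<lambda>v w. (v, w) \<in> lenlex less_than)"
      using asym unfolding asymp_on_def asym_on_def by blast
    moreover have "transp_on T (\<lambda>v w. (v, w) \<in> lenlex less_than)"
      using trans unfolding transp_on_def trans_on_def by blast
    ultimately show thesis
      using Finite_Set.bex_max_element[OF assms(1) _ _ assms(2)] that by blast
  qed
  have "v \<in> smaller_words r w" if "v \<in> T - {w}" for v
    using smaller_or_equal_words[of v w] w that assms(3) by (auto simp: smaller_words_def)
  with w(1) show ?thesis by blast
qed

lemma model_if_card_short_normal_words:
  assumes d: "\<And>n. 1 \<le> n \<Longrightarrow> d n = card (short_normal_words n)" and "short_normal_words 1 \<noteq> {}"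
  shows "\<exists>F\<in>model_functions. growth_equiv d F"
proof (rule language_growth_equiv_model[where L = normal_words and \<delta> = 1 and X = "{..<r}"])
  show "1 \<le> d 1"
    using assms finite_short_normal_words[of 1] by (simp add: Suc_le_eq card_gt_0_iff)
qed (use d card_short_normal_words factor_closed_normal_words normal_words_subset in
    \<open>auto simp: normal_words_def\<close>)

end

section \<open>Necessity for semigroups\<close>

theorem semigroup_growth_equiv_model:
  assumes "semigroup_on S mul" "S \<noteq> {}" "finite X" "semigroup_on.generates S mul X"
  shows "\<exists>F\<in>model_functions. growth_equiv (semigroup_growth mul X) F"
proof -
  interpret semigroup_on S mul by fact
  obtain f and r :: nat where X: "X = f ` {..<r}"
    using assms(3) unfolding finite_conv_nat_seg_image lessThan_def by blast
  have XS: "X \<subseteq> S" "subsemigroup hull X = S"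
    using assms(4) by (auto simp: generates_def)
  interpret word_reduction S mul f r "\<lambda>B. B"
    by unfold_locales (use X XS in auto)
  have image: "val ` nonempty_words r n = val ` short_normal_words n" for n
    using val_in_cl_normal by blast
  show ?thesis
  proof (rule model_if_card_short_normal_words)
    fix n :: nat
    have "inj_on val (short_normal_words n)"
      by (rule inj_on_subset[OF inj_on_val_normal]) (auto simp: nonempty_words_def)
    then show "semigroup_growth mul X n = card (short_normal_words n)"
      unfolding semigroup_growth_def X Union_set_power_image image by (rule card_image)
  next
    have "X \<noteq> {}"
    proof
      assume "X = {}"
      then have "subsemigroup hull X \<subseteq> {}"
        by (intro hull_minimal) (auto simp: subsemigroup_def)
      with XS assms(2) show False by simp
    qed
    then obtain i where "i < r"
      using X by auto
    then have "[i] \<in> nonempty_words r 1"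
      by (simp add: nonempty_words_def)
    with image[of 1] show "short_normal_words 1 \<noteq> {}" by blast
  qed
qed

section \<open>Necessity for algebras\<close>

context assoc_algebra_on
begin

sublocale semigroup_on A mul
  by (rule semigroup_mul)

lemma span_carrier: "B \<subseteq> A \<Longrightarrow> span B \<subseteq> A"
  by (rule span_minimal[OF _ subspace_carrier])

lemma mul_zero: "a \<in> A \<Longrightarrow> mul a 0 = 0" "a \<in> A \<Longrightarrow> mul 0 a = 0"
  using mul_add_right[of a 0 0] mul_add_left[of 0 0 a] subspace_0[OF subspace_carrier] by auto

lemma mul_span_right:
  assumes a: "a \<in> A" and B: "B \<subseteq> A" and x: "x \<in> span B"
  shows "mul a x \<in> span (mul a ` B)"
proof -
  have "span B \<subseteq> {x \<in> A. mul a x \<in> span (mul a ` B)}"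
  proof (rule span_minimal)
    show "B \<subseteq> {x \<in> A. mul a x \<in> span (mul a ` B)}"
      using B by (auto intro: span_base)
    show "subspace {x \<in> A. mul a x \<in> span (mul a ` B)}"
      by (rule subspaceI)
        (use a subspace_carrier in \<open>auto simp: mul_zero mul_add_right mul_scale_right span_zero span_add span_scale
          subspace_0 subspace_add subspace_scale\<close>)
  qed
  with x show ?thesis by blast
qed

lemma mul_span_left:
  assumes a: "a \<in> A" and B: "B \<subseteq> A" and x: "x \<in> span B"
  shows "mul x a \<in> span ((\<lambda>b. mul b a) ` B)"
proof -
  have "span B \<subseteq> {x \<in> A. mul x a \<in> span ((\<lambda>b. mul b a) ` B)}"
  proof (rule span_minimal)
    show "B \<subseteq> {x \<in> A. mul x a \<in> span ((\<lambda>b. mul b a) ` B)}"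
      using B by (auto intro: span_base)
    show "subspace {x \<in> A. mul x a \<in> span ((\<lambda>b. mul b a) ` B)}"
      by (rule subspaceI)
        (use a subspace_carrier in \<open>auto simp: mul_zero mul_add_left mul_scale_left span_zero span_add span_scale
          subspace_0 subspace_add subspace_scale\<close>)
  qed
  with x show ?thesis by blast
qed

lemma mul_span_span:
  assumes B: "B \<subseteq> A" and C: "C \<subseteq> A" and x: "x \<in> span B" and y: "y \<in> span C"
  shows "mul x y \<in> span {mul b c |b c. b \<in> B \<and> c \<in> C}"
proof -
  have "mul x y \<in> span ((\<lambda>b. mul b y) ` B)"
    using mul_span_left B x y span_carrier[OF C] by blast
  also have "\<dots> \<subseteq> span {mul b c |b c. b \<in> B \<and> c \<in> C}"
  proof (intro span_minimal subspace_span image_subsetI)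
    fix b assume b: "b \<in> B"
    have "mul b y \<in> span (mul b ` C)"
      using mul_span_right B C b y by blast
    also have "\<dots> \<subseteq> span {mul b c |b c. b \<in> B \<and> c \<in> C}"
      by (rule span_mono) (use b in auto)
    finally show "mul b y \<in> span {mul b c |b c. b \<in> B \<and> c \<in> C}" .
  qed
  finally show ?thesis .
qed

lemma set_power_mono: "X \<subseteq> Y \<Longrightarrow> set_power mul X m \<subseteq> set_power mul Y m"
proof (induction m)
  case (Suc m)
  then show ?case by (cases m) (simp_all, blast)
qed simp

lemma set_power_carrier: "X \<subseteq> A \<Longrightarrow> set_power mul X m \<subseteq> A"
proof (induction m)
  case (Suc m)
  then show ?case by (cases m) (auto intro!: mul_closed)
qed simp

lemma set_power_span:
  assumes X: "X \<subseteq> A"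
  shows "set_power mul (span X) m \<subseteq> span (set_power mul X m)"
proof (induction m)
  case (Suc m)
  show ?case
  proof (cases m)
    case (Suc k)
    show ?thesis
    proof
      fix z assume "z \<in> set_power mul (span X) (Suc m)"
      then obtain x y where z: "z = mul x y" "x \<in> span X" "y \<in> span (set_power mul X m)"
        using Suc.IH Suc by auto
      show "z \<in> span (set_power mul X (Suc m))"
        using mul_span_span[OF X set_power_carrier[OF X] z(2,3)] by (simp add: z(1) Suc)
    qed
  qed simp
qed simp

text \<open>Lets a finite spanning set replace the generating subspace, so that words over a finite
  alphabet describe the algebra.\<close>

lemma span_Union_set_power_span:
  assumes X: "X \<subseteq> A"
  shows "span (\<Union>m\<in>I. set_power mul (span X) m) = span (\<Union>m\<in>I. set_power mul X m)"
proof (rule antisym)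
  show "span (\<Union>m\<in>I. set_power mul (span X) m) \<subseteq> span (\<Union>m\<in>I. set_power mul X m)"
  proof (intro span_minimal subspace_span UN_least)
    fix m assume "m \<in> I"
    then have "span (set_power mul X m) \<subseteq> span (\<Union>m\<in>I. set_power mul X m)"
      by (intro span_mono) blast
    then show "set_power mul (span X) m \<subseteq> span (\<Union>m\<in>I. set_power mul X m)"
      using set_power_span[OF X] by blast
  qed
  show "span (\<Union>m\<in>I. set_power mul X m) \<subseteq> span (\<Union>m\<in>I. set_power mul (span X) m)"
    by (intro span_mono UN_mono set_power_mono span_superset) simp
qed

theorem growth_equiv_model:
  assumes "A \<noteq> {0}" "generating_subspace V"
  shows "\<exists>F\<in>model_functions. growth_equiv (growth V) F"
proof -
  obtain B where B: "finite B" "V = span B" "V \<subseteq> A" "subalgebra hull V = A"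
    using assms(2) by (auto simp: generating_subspace_def)
  obtain f and r :: nat where X: "B = f ` {..<r}"
    using B(1) unfolding finite_conv_nat_seg_image lessThan_def by blast
  have BA: "B \<subseteq> A"
    using B span_superset by blast
  interpret word_reduction A mul f r span
    by unfold_locales
      (use X BA mul_span_left mul_span_right span_superset in \<open>auto intro: span_minimal[THEN subsetD]\<close>)
  \<comment> \<open>The value of the largest word is outside the span of the values of all smaller
    words, in particular of the others in \<open>T\<close>.\<close>
  have indep: "independent (val ` T)" if "finite T" "T \<subseteq> normal_words - {[]}" for T
    using that
  proof (induction "card T" arbitrary: T)
    case 0
    then show ?case by (simp add: independent_empty)
  next
    case (Suc k)
    then have "T \<noteq> {}" by auto
    then obtain w where w: "w \<in> T" "T - {w} \<subseteq> smaller_words r w"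
      using largest_word[of T] Suc.prems normal_words_subset by blast
    have "val w \<notin> span (val ` (T - {w}))"
      using span_mono[OF image_mono[OF w(2)], of val] w(1) Suc.prems by (auto simp: normal_words_def)
    moreover have "independent (val ` (T - {w}))"
      using Suc w(1) by (intro Suc.hyps(1)) auto
    ultimately have "independent (insert (val w) (val ` (T - {w})))"
      by (rule independent_insertI)
    moreover have "insert (val w) (val ` (T - {w})) = val ` T"
      using w(1) by auto
    ultimately show ?case by simp
  qed
  show ?thesis
  proof (rule model_if_card_short_normal_words)
    fix n :: nat
    have nonempty: "short_normal_words n \<subseteq> normal_words - {[]}"
      by (auto simp: nonempty_words_def)
    have "span (val ` nonempty_words r n) = span (val ` short_normal_words n)"
      using val_in_cl_normal[of _ n]
      by (intro antisym span_minimal subspace_span span_mono) auto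
    then have "growth V n = dim (span (val ` short_normal_words n))"
      unfolding growth_def B(2) span_Union_set_power_span[OF BA] unfolding X Union_set_power_image by simp
    also have "\<dots> = card (val ` short_normal_words n)"
      by (rule dim_span_eq_card_independent[OF indep[OF finite_short_normal_words nonempty]])
    also have "\<dots> = card (short_normal_words n)"
      by (rule card_image[OF inj_on_subset[OF inj_on_val_normal nonempty]])
    finally show "growth V n = card (short_normal_words n)" .
  next
    show "short_normal_words 1 \<noteq> {}"
    proof
      assume empty: "short_normal_words 1 = {}"
      \<comment> \<open>Without normal letters every generator lies in the span of the empty set,
        which makes \<open>A\<close> zero.\<close>
      have "b = 0" if "b \<in> B" for b
      proof -
        obtain i where i: "i < r" "b = f i"
          using \<open>b \<in> B\<close> unfolding X by blast
        then have "val [i] \<in> span {}"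
          using val_in_cl_normal[of "[i]" 1] empty by (simp add: nonempty_words_def)
        with i show ?thesis by simp
      qed
      then have "B \<subseteq> {0}" by blast
      then have "V \<subseteq> {0}"
        using span_mono[of B "{0}"] B(2) by simp
      then have "subalgebra hull V \<subseteq> {0}"
        using subspace_0[OF subspace_carrier]
        by (intro hull_minimal) (auto simp: subalgebra_def mul_zero)
      then show False
        using B(4) assms(1) subspace_0[OF subspace_carrier] by auto
    qed
  qed
qed

end

section \<open>Model functions as growth functions of languages\<close>

lemma constant_language:
  assumes "1 \<le> c"
  shows "\<exists>L. factor_closed L \<and> L \<noteq> {} \<and> L \<subseteq> lists {0 :: nat} \<and> growth_equiv (\<lambda>n. c) (language_growth L)"
proof -
  define L where "L = {w \<in> lists {0 :: nat}. length w < c}"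
  have unary: "w = replicate (length w) 0" if "w \<in> lists {0 :: nat}" for w
    using that by (induction w) auto
  have L: "factor_closed L" "L \<subseteq> lists {0}" "L \<noteq> {}"
    using assms by (auto simp: L_def factor_closed_def lists_eq_set
        dest: set_mono_sublist sublist_length_le intro!: exI[of _ "[]"])
  have growth: "language_growth L n = min c (n + 1)" for n
  proof -
    have "{w \<in> L. length w \<le> n} = (\<lambda>j. replicate j 0) ` {..<min c (n + 1)}"
      using unary by (fastforce simp: L_def)
    moreover have "inj_on (\<lambda>j. replicate j (0 :: nat)) {..<min c (n + 1)}"
      by (rule inj_onI) (metis length_replicate)
    ultimately show ?thesis
      by (simp add: language_growth_def card_image)
  qed
  have "growth_equiv (\<lambda>n. c) (language_growth L)"
    unfolding growth
  \<comment> \<open>The language is exhausted at length \<open>c - 1\<close>.\<close>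
  proof (rule growth_equivI[where C = c and D = 1])
    fix n :: nat assume "1 \<le> n"
    then have "c * 1 \<le> c * n" by (rule mult_le_mono2)
    then show "c \<le> min c (c * n + 1)" by (intro min.boundedI) linarith+
  qed (use assms in auto)
  with L show ?thesis by blast
qed

lemma linear_language:
  assumes "1 \<le> a"
  shows "\<exists>L. factor_closed L \<and> L \<noteq> {} \<and> L \<subseteq> lists {0 :: nat} \<and> growth_equiv (\<lambda>n. a * n + b) (language_growth L)"
proof -
  define L where "L = lists {0 :: nat}"
  have unary: "w = replicate (length w) 0" if "w \<in> lists {0 :: nat}" for w
    using that by (induction w) auto
  have L: "factor_closed L" "L \<subseteq> lists {0}" "L \<noteq> {}"
    by (auto simp: L_def factor_closed_def lists_eq_set dest: set_mono_sublist intro!: exI[of _ "[]"])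
  have growth: "language_growth L n = n + 1" for n
  proof -
    have "{w \<in> L. length w \<le> n} = (\<lambda>j. replicate j 0) ` {..n}"
      using unary by (fastforce simp: L_def)
    moreover have "inj_on (\<lambda>j. replicate j (0 :: nat)) {..n}"
      by (rule inj_onI) (metis length_replicate)
    ultimately show ?thesis
      by (simp add: language_growth_def card_image)
  qed
  have "growth_equiv (\<lambda>n. a * n + b) (language_growth L)"
    unfolding growth
  proof (rule growth_equivI[where C = "a + b" and D = 2])
    fix n :: nat assume n: "1 \<le> n"
    have "b * 1 \<le> b * n" using n by (rule mult_le_mono2)
    then show "a * n + b \<le> (a + b) * n + 1" unfolding distrib_right by linarith
    have "1 * n \<le> a * n" using assms by (rule mult_le_mono1)
    then have "n + 1 \<le> a * n + a * n" using n by linarith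
    then show "n + 1 \<le> a * (2 * n) + b" by (simp add: mult.left_commute)
    show "1 \<le> a * n + b" using n assms by (simp add: Suc_le_eq)
  qed (use assms in \<open>auto intro: mult_le_mono2\<close>)
  with L show ?thesis by blast
qed

theorem model_function_language:
  assumes "F \<in> model_functions"
  shows "\<exists>L. factor_closed L \<and> L \<noteq> {} \<and> L \<subseteq> lists {0, 1 :: nat} \<and> growth_equiv F (language_growth L)"
proof -
  consider c where "1 \<le> c" "F = (\<lambda>n. c)" | a b where "1 \<le> a" "F = (\<lambda>n. a * n + b)"
    | "superlinear_growth F"
    using assms unfolding model_functions_def constant_function_def linear_function_def superlinear_growth_def
    by blast
  moreover have "lists {0} \<subseteq> lists {0, 1 :: nat}"
    by (rule lists_mono) simp
  ultimately show ?thesis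
    using constant_language linear_language superlinear_growth.superlinear_language
    by (metis order_trans)
qed

lemma language_growth_functionsI:
  fixes X :: "'a set"
  assumes "finite X" "factor_closed L" "L \<noteq> {}" "L \<subseteq> lists X"
  shows "language_growth L \<in> language_growth_functions TYPE('a)"
  using assms hereditary_language_of_factor_closed[OF assms(2,4)]
  unfolding language_growth_functions_def
  by (intro CollectI exI[of _ X] exI[of _ "lists X - L"]) auto

theorem language_growth_functions_equiv_model:
  assumes "d \<in> language_growth_functions TYPE('x)"
  shows "\<exists>F\<in>model_functions. growth_equiv d F"
proof -
  obtain X :: "'x set" and W where d: "d = language_growth (hereditary_language X W)"
    and X: "finite X" and ne: "hereditary_language X W \<noteq> {}"
    using assms by (auto simp: language_growth_functions_def)
  let ?L = "hereditary_language X W"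
  have sub: "?L \<subseteq> lists X"
    by (auto simp: hereditary_language_def)
  have "[] \<in> ?L"
    by (rule factor_closed_Nil[OF factor_closed_hereditary_language ne])
  then have "{w \<in> ?L. length w \<le> 1} \<noteq> {}" by auto
  then have "1 \<le> d 1"
    using finite_bounded_words[OF X sub, of 1] unfolding d language_growth_def
    by (simp add: Suc_le_eq card_gt_0_iff)
  then show ?thesis
    by (intro language_growth_equiv_model[OF X factor_closed_hereditary_language sub ne, where \<delta> = 0])
      (simp_all add: d)
qed


section \<open>The semigroup of a factor-closed language\<close>

declare list_encode.simps [simp del]

text \<open>The empty word, which is encoded by \<open>0\<close>, serves as the zero of the semigroup, so that words
  outside of the language do not need an extra element.\<close>

definition language_mul :: "nat list set \<Rightarrow> nat \<Rightarrow> nat \<Rightarrow> nat" where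
  "language_mul L x y =
     (let u = list_decode x; v = list_decode y
      in if u = [] \<or> v = [] \<or> u @ v \<notin> L then 0 else list_encode (u @ v))"

lemma language_mul_list_encode:
  "language_mul L (list_encode u) (list_encode v)
    = list_encode (if u = [] \<or> v = [] \<or> u @ v \<notin> L then [] else u @ v)"
  by (simp add: language_mul_def list_encode.simps(1))

lemma semigroup_on_language:
  assumes L: "factor_closed L" "L \<noteq> {}"
  shows "semigroup_on (list_encode ` L) (language_mul L)"
proof
  have Nil: "[] \<in> L" by (rule factor_closed_Nil[OF L])
  show "language_mul L x y \<in> list_encode ` L" if "x \<in> list_encode ` L" "y \<in> list_encode ` L" for x y
    using that Nil by (auto simp: language_mul_list_encode)
  fix x y z assume "x \<in> list_encode ` L" "y \<in> list_encode ` L" "z \<in> list_encode ` L"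
  then obtain u v w where x: "x = list_encode u" and y: "y = list_encode v" and z: "z = list_encode w"
    by blast
  \<comment> \<open>With this, both bracketings give \<open>u @ v @ w\<close> if it is in
    \<open>L\<close> and all three words are nonempty, and the zero otherwise.\<close>
  have "u @ v \<in> L \<and> v @ w \<in> L" if "u @ v @ w \<in> L"
    using factor_closedD[OF L(1) that, of "u @ v"] factor_closedD[OF L(1) that, of "v @ w"]
    by (metis append_assoc sublist_append_leftI sublist_append_rightI)
  then show "language_mul L (language_mul L x y) z = language_mul L x (language_mul L y z)"
    unfolding x y z by (simp add: language_mul_list_encode)
qed

lemma language_semigroup:
  fixes X :: "nat set"
  assumes fin: "finite X" and L: "factor_closed L" "L \<noteq> {}" "L \<subseteq> lists X"
  shows "\<exists>(S :: nat set) mul Y. semigroup_on S mul \<and> S \<noteq> {} \<and> finite Y \<and> semigroup_on.generates S mul Y \<and>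
    (\<forall>n\<ge>1. semigroup_growth mul Y n = language_growth L n)"
proof -
  let ?S = "list_encode ` L" and ?mul = "language_mul L"
  \<comment> \<open>The zero is taken as a generator: it is then counted from \<open>n = 1\<close>
    on, like the empty word, and is generated even if no product of letters vanishes.\<close>
  let ?Y = "list_encode ` {w \<in> L. length w \<le> 1}"
  interpret semigroup_on ?S ?mul
    by (rule semigroup_on_language[OF L(1,2)])
  have Nil: "[] \<in> L" by (rule factor_closed_Nil[OF L(1,2)])
  have cons: "?mul (list_encode [a]) (list_encode w) = list_encode (a # w)" if "a # w \<in> L" "w \<noteq> []" for a w
    using that by (simp add: language_mul_list_encode)
  have letter: "[a] \<in> L" "w \<in> L" if "a # w \<in> L" for a w
    using factor_closed_take[OF L(1) that, of 1] factor_closed_drop[OF L(1) that, of 1] by auto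
  have "subsemigroup hull ?Y = ?S"
  proof (rule hull_unique)
    show "?Y \<subseteq> ?S" by auto
    show "subsemigroup ?S" by (auto simp: subsemigroup_def mul_closed)
    fix T assume T: "?Y \<subseteq> T" "subsemigroup T"
    have "list_encode w \<in> T" if "w \<in> L" for w
      using that
    proof (induction w)
      case Nil
      then show ?case using T(1) by auto
    next
      case (Cons a w)
      show ?case
      proof (cases "w = []")
        case True
        then show ?thesis using T(1) Cons.prems by auto
      next
        case False
        have "list_encode [a] \<in> T" "list_encode w \<in> T"
          using T(1) letter[OF Cons.prems] Cons.IH by auto
        then show ?thesis
          using T(2) cons[OF Cons.prems False] unfolding subsemigroup_def by metis
      qed
    qed
    then show "?S \<subseteq> T" by blast
  qed
  then have "generates ?Y"
    by (auto simp: generates_def)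
  moreover have "finite ?Y"
    by (intro finite_imageI finite_bounded_words[OF fin L(3)])
  moreover have "semigroup_growth ?mul ?Y n = language_growth L n" if n: "1 \<le> n" for n
  proof -
    have upper: "set_power ?mul ?Y k \<subseteq> list_encode ` {w \<in> L. length w \<le> k}" for k
    proof (induction k)
      case (Suc k)
      show ?case
      proof (cases k)
        case (Suc j)
        show ?thesis
        proof
          fix z assume "z \<in> set_power ?mul ?Y (Suc k)"
          then obtain u v where z: "z = ?mul (list_encode u) (list_encode v)"
            "u \<in> L" "length u \<le> 1" "v \<in> L" "length v \<le> k"
            using Suc.IH Suc by fastforce
          then show "z \<in> list_encode ` {w \<in> L. length w \<le> Suc k}"
            unfolding z(1) language_mul_list_encode using Nil by (intro imageI) auto
        qed
      qed simp
    qed simp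
    have lower: "w \<in> L \<Longrightarrow> w \<noteq> [] \<Longrightarrow> list_encode w \<in> set_power ?mul ?Y (length w)" for w
    proof (induction w)
      case (Cons a w)
      show ?case
      proof (cases "w = []")
        case False
        then obtain j where j: "length w = Suc j" by (cases w) auto
        have "list_encode w \<in> set_power ?mul ?Y (Suc j)" "list_encode [a] \<in> ?Y"
          using Cons.IH letter[OF Cons.prems(1)] False j by auto
        then show ?thesis
          using cons[OF Cons.prems(1) False, symmetric] j by simp blast
      qed (use Cons.prems in auto)
    qed simp
    have "(\<Union>k\<in>{1..n}. set_power ?mul ?Y k) = list_encode ` {w \<in> L. length w \<le> n}"
    proof (intro antisym UN_least)
      fix k assume "k \<in> {1..n}"
      then show "set_power ?mul ?Y k \<subseteq> list_encode ` {w \<in> L. length w \<le> n}"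
        using upper[of k] by fastforce
    next
      show "list_encode ` {w \<in> L. length w \<le> n} \<subseteq> (\<Union>k\<in>{1..n}. set_power ?mul ?Y k)"
      proof (rule image_subsetI)
        fix w assume w: "w \<in> {w \<in> L. length w \<le> n}"
        show "list_encode w \<in> (\<Union>k\<in>{1..n}. set_power ?mul ?Y k)"
        proof (cases "w = []")
          case True
          then have "list_encode w \<in> set_power ?mul ?Y 1"
            using Nil by auto
          then show ?thesis using n by (metis UN_I atLeastAtMost_iff le_refl)
        next
          case False
          then show ?thesis
            using w lower[of w] by (intro UN_I[of "length w"]) (auto simp: Suc_le_eq)
        qed
      qed
    qed
    then show ?thesis
      unfolding semigroup_growth_def language_growth_def
      by (simp add: card_image inj_list_encode)
  qed
  ultimately show ?thesis
    using semigroup_on_axioms L(2) by blast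
qed


section \<open>The semigroup algebra\<close>

lemma vector_space_smult: "vector_space (smult :: 'k::field \<Rightarrow> 'k poly \<Rightarrow> 'k poly)"
  by unfold_locales (auto simp: smult_add_right smult_add_left)

text \<open>The product of the semigroup algebra. A polynomial serves merely as a finitely supported
  function, with \<open>monom 1 i\<close> standing for the semigroup element \<open>i\<close>, and
  \<open>mul\<close> is extended bilinearly.\<close>

definition poly_mul :: "(nat \<Rightarrow> nat \<Rightarrow> nat) \<Rightarrow> 'k::field poly \<Rightarrow> 'k poly \<Rightarrow> 'k poly" where
  "poly_mul mul p q = (\<Sum>i\<le>degree p. \<Sum>j\<le>degree q. monom (coeff p i * coeff q j) (mul i j))"

text \<open>Summation bounds that do not follow the degrees exactly allow sums and multiples to be
  compared term by term.\<close>

lemma poly_mul_eq: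
  assumes "degree p \<le> M" "degree q \<le> N"
  shows "poly_mul mul p q = (\<Sum>i\<le>M. \<Sum>j\<le>N. monom (coeff p i * coeff q j) (mul i j))"
proof -
  have "poly_mul mul p q = (\<Sum>i\<le>degree p. \<Sum>j\<le>N. monom (coeff p i * coeff q j) (mul i j))"
    unfolding poly_mul_def
    by (intro sum.cong refl sum.mono_neutral_left) (use assms in \<open>auto simp: coeff_eq_0\<close>)
  also have "\<dots> = (\<Sum>i\<le>M. \<Sum>j\<le>N. monom (coeff p i * coeff q j) (mul i j))"
    by (intro sum.mono_neutral_left) (use assms in \<open>auto simp: coeff_eq_0\<close>)
  finally show ?thesis .
qed

lemma poly_mul_add_left: "poly_mul mul (p + q) r = poly_mul mul p r + poly_mul mul q r"
proof -
  let ?M = "max (degree p) (degree q)"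
  have "degree (p + q) \<le> ?M" by (rule degree_add_le_max)
  then show ?thesis
    by (simp add: poly_mul_eq[of _ ?M r "degree r"] distrib_right add_monom[symmetric] sum.distrib)
qed

lemma poly_mul_add_right: "poly_mul mul r (p + q) = poly_mul mul r p + poly_mul mul r q"
proof -
  let ?M = "max (degree p) (degree q)"
  have "degree (p + q) \<le> ?M" by (rule degree_add_le_max)
  then show ?thesis
    by (simp add: poly_mul_eq[of r "degree r" _ ?M] distrib_left add_monom[symmetric] sum.distrib)
qed

lemma smult_sum: "smult c (\<Sum>i\<in>I. g i) = (\<Sum>i\<in>I. smult c (g i))"
  by (induction I rule: infinite_finite_induct) (simp_all add: smult_add_right)

lemma poly_mul_smult_left: "poly_mul mul (smult c p) q = smult c (poly_mul mul p q)"
  using degree_smult_le[of c p]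
  by (simp add: poly_mul_eq[of _ "degree p" q "degree q"] smult_sum smult_monom mult.assoc)

lemma poly_mul_smult_right: "poly_mul mul p (smult c q) = smult c (poly_mul mul p q)"
  using degree_smult_le[of c q]
  by (simp add: poly_mul_eq[of p "degree p" _ "degree q"] smult_sum smult_monom mult.left_commute)

lemma poly_mul_zero [simp]: "poly_mul mul 0 q = 0" "poly_mul mul p 0 = 0"
  by (simp_all add: poly_mul_def)

lemma poly_mul_sum_left: "poly_mul mul (\<Sum>i\<in>I. g i) q = (\<Sum>i\<in>I. poly_mul mul (g i) q)"
  by (induction I rule: infinite_finite_induct) (simp_all add: poly_mul_add_left)

lemma poly_mul_sum_right: "poly_mul mul p (\<Sum>i\<in>I. g i) = (\<Sum>i\<in>I. poly_mul mul p (g i))"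
  by (induction I rule: infinite_finite_induct) (simp_all add: poly_mul_add_right)

lemma poly_mul_monom: "poly_mul mul (monom a i) (monom b j) = monom (a * b) (mul i j)"
proof -
  have "poly_mul mul (monom a i) (monom b j)
      = (\<Sum>i'\<le>i. \<Sum>j'\<le>j. monom (coeff (monom a i) i' * coeff (monom b j) j') (mul i' j'))"
    by (rule poly_mul_eq[OF degree_monom_le degree_monom_le])
  also have "\<dots> = (\<Sum>i'\<le>i. if i' = i then monom (a * b) (mul i j) else 0)"
  proof (rule sum.cong[OF refl])
    fix i'
    have "(\<Sum>j'\<le>j. monom (coeff (monom a i) i' * coeff (monom b j) j') (mul i' j'))
        = (\<Sum>j'\<le>j. if j' = j then (if i' = i then monom (a * b) (mul i j) else 0) else 0)"
      by (rule sum.cong) auto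
    then show "(\<Sum>j'\<le>j. monom (coeff (monom a i) i' * coeff (monom b j) j') (mul i' j'))
        = (if i' = i then monom (a * b) (mul i j) else 0)"
      by simp
  qed
  finally show ?thesis by simp
qed

definition polys_over :: "nat set \<Rightarrow> 'k::field poly set" where
  "polys_over S = {p. \<forall>i. coeff p i \<noteq> 0 \<longrightarrow> i \<in> S}"

lemma polys_over_sum_monoms:
  assumes "p \<in> polys_over S"
  obtains I where "finite I" "I \<subseteq> S" "p = (\<Sum>i\<in>I. monom (coeff p i) i)"
proof
  let ?I = "{i. i \<le> degree p \<and> coeff p i \<noteq> 0}"
  show "?I \<subseteq> S"
    using assms by (auto simp: polys_over_def)
  have "p = (\<Sum>i\<le>degree p. monom (coeff p i) i)"
    by (simp add: poly_as_sum_of_monoms)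
  also have "\<dots> = (\<Sum>i\<in>?I. monom (coeff p i) i)"
    by (rule sum.mono_neutral_right) auto
  finally show "p = (\<Sum>i\<in>?I. monom (coeff p i) i)" .
qed simp

text \<open>Reduces closure and associativity of the product to monomials.\<close>

lemma polys_over_induct [consumes 1, case_names monom sum]:
  assumes p: "p \<in> polys_over S" and monom: "\<And>c i. i \<in> S \<Longrightarrow> P (monom c i)"
    and sum: "\<And>(I :: nat set) g. finite I \<Longrightarrow> (\<And>i. i \<in> I \<Longrightarrow> P (g i)) \<Longrightarrow> P (\<Sum>i\<in>I. g i)"
  shows "P p"
proof -
  obtain I where I: "finite I" "I \<subseteq> S" "p = (\<Sum>i\<in>I. monom (coeff p i) i)"
    using polys_over_sum_monoms[OF p] .
  have "P (\<Sum>i\<in>I. monom (coeff p i) i)"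
    using I monom by (intro sum) auto
  then show ?thesis using I(3) by simp
qed

lemma monom_in_polys_over: "i \<in> S \<Longrightarrow> monom c i \<in> polys_over S"
  by (simp add: polys_over_def)

lemma sum_in_polys_over: "(\<And>i. i \<in> I \<Longrightarrow> g i \<in> polys_over S) \<Longrightarrow> (\<Sum>i\<in>I. g i) \<in> polys_over S"
  unfolding polys_over_def coeff_sum mem_Collect_eq by (meson sum.neutral)

lemma semigroup_on_polys_over:
  assumes "semigroup_on S mul"
  shows "semigroup_on (polys_over S :: 'k::field poly set) (poly_mul mul)"
proof
  interpret semigroup_on S mul by fact
  fix p q r :: "'k poly"
  assume p: "p \<in> polys_over S" and q: "q \<in> polys_over S"
  have "poly_mul mul (monom c i) q \<in> polys_over S" if i: "i \<in> S" for c i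
    using q
  proof (induction q rule: polys_over_induct)
    case (monom b j)
    then show ?case by (simp add: poly_mul_monom monom_in_polys_over mul_closed i)
  next
    case (sum I g)
    then show ?case by (simp add: poly_mul_sum_right sum_in_polys_over)
  qed
  with p show "poly_mul mul p q \<in> polys_over S"
  proof (induction p rule: polys_over_induct)
    case (sum I g)
    then show ?case by (simp add: poly_mul_sum_left sum_in_polys_over)
  qed
  assume r: "r \<in> polys_over S"
  \<comment> \<open>Associativity is extended from monomials one argument at a time: first in
    \<open>r\<close>, then in \<open>q\<close>, then in \<open>p\<close>.\<close>
  have 1: "poly_mul mul (poly_mul mul (monom a i) (monom b j)) r
      = poly_mul mul (monom a i) (poly_mul mul (monom b j) r)" if ij: "i \<in> S" "j \<in> S" for a b i j
    using r
  proof (induction r rule: polys_over_induct)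
    case (monom c k)
    then show ?case by (simp add: poly_mul_monom mul_assoc mult.assoc ij)
  next
    case (sum I g)
    then show ?case by (simp add: poly_mul_sum_right)
  qed
  have 2: "poly_mul mul (poly_mul mul (monom a i) q) r
      = poly_mul mul (monom a i) (poly_mul mul q r)" if i: "i \<in> S" for a i
    using q
  proof (induction q rule: polys_over_induct)
    case (monom b j)
    then show ?case by (rule 1[OF i])
  next
    case (sum I g)
    then show ?case by (simp add: poly_mul_sum_left poly_mul_sum_right)
  qed
  show "poly_mul mul (poly_mul mul p q) r = poly_mul mul p (poly_mul mul q r)"
    using p
  proof (induction p rule: polys_over_induct)
    case (monom a i)
    then show ?case by (rule 2)
  next
    case (sum I g)
    then show ?case by (simp add: poly_mul_sum_left)
  qed
qed

lemma assoc_algebra_on_polys_over: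
  assumes "semigroup_on S mul"
  shows "assoc_algebra_on smult (polys_over S :: 'k::field poly set) (poly_mul mul)"
proof -
  interpret vector_space "smult :: 'k \<Rightarrow> 'k poly \<Rightarrow> 'k poly"
    by (rule vector_space_smult)
  have "subspace (polys_over S :: 'k poly set)"
    unfolding polys_over_def by (intro subspaceI) (auto, metis add.right_neutral)
  then show ?thesis
    using semigroup_on_polys_over[OF assms]
    by unfold_locales
      (auto simp: semigroup_on_def poly_mul_add_left poly_mul_add_right poly_mul_smult_left poly_mul_smult_right)
qed

lemma monom_1_inject: "monom (1 :: 'k::field) i = monom 1 j \<longleftrightarrow> i = j"
  using degree_monom_eq[of "1 :: 'k"] zero_neq_one by metis

lemma independent_monoms:
  "\<not> module.dependent smult (monom (1 :: 'k::field) ` U)"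
proof -
  interpret vector_space "smult :: 'k \<Rightarrow> 'k poly \<Rightarrow> 'k poly"
    by (rule vector_space_smult)
  show ?thesis
    unfolding independent_explicit_module
  proof (intro allI impI)
    fix t u v assume t: "finite t" "t \<subseteq> monom (1 :: 'k) ` U" "(\<Sum>v\<in>t. smult (u v) v) = 0" "v \<in> t"
    obtain i where i: "v = monom 1 i" using t(2,4) by auto
    have "0 = coeff (\<Sum>w\<in>t. smult (u w) w) i" using t(3) by simp
    also have "\<dots> = (\<Sum>w\<in>t. if w = v then u v else 0)"
      unfolding coeff_sum
    proof (rule sum.cong[OF refl])
      fix w assume "w \<in> t"
      then obtain k where "w = monom 1 k" using t(2) by auto
      then show "coeff (smult (u w) w) i = (if w = v then u v else 0)"
        using i by (auto simp: monom_1_inject)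
    qed
    also have "\<dots> = u v" using t(1,4) by simp
    finally show "u v = 0" by simp
  qed
qed

text \<open>Products of generators are monomials, and distinct monomials are linearly independent,
  so the dimension counts semigroup elements and the two growth functions are equal.\<close>

theorem semigroup_algebra:
  fixes S :: "nat set"
  assumes S: "semigroup_on S mul" "S \<noteq> {}" and X: "finite X" "semigroup_on.generates S mul X"
  shows "semigroup_growth mul X \<in> algebra_growth_functions (smult :: 'k::field \<Rightarrow> 'k poly \<Rightarrow> 'k poly)"
proof -
  interpret S: semigroup_on S mul by fact
  let ?A = "polys_over S :: 'k poly set" and ?m = "monom (1 :: 'k)"
  interpret assoc_algebra_on smult ?A "poly_mul mul"
    by (rule assoc_algebra_on_polys_over[OF S(1)])
  let ?V = "span (?m ` X)"
  have XS: "X \<subseteq> S" "S.subsemigroup hull X = S"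
    using X(2) by (auto simp: S.generates_def)
  have mXA: "?m ` X \<subseteq> ?A"
    using XS(1) by (auto intro: monom_in_polys_over)
  have "?V \<subseteq> ?A"
    by (rule span_carrier[OF mXA])
  have "subalgebra hull ?V = ?A"
  proof (rule hull_unique)
    show "subalgebra ?A"
      using subspace_carrier mul_closed by (auto simp: subalgebra_def)
    fix T assume T: "?V \<subseteq> T" "subalgebra T"
    \<comment> \<open>The elements whose monomials lie in \<open>T\<close> form a subsemigroup
      containing \<open>X\<close>, hence all of \<open>S\<close>.\<close>
    have "S.subsemigroup hull X \<subseteq> {x \<in> S. ?m x \<in> T}"
    proof (rule hull_minimal)
      show "X \<subseteq> {x \<in> S. ?m x \<in> T}"
        using XS(1) T(1) span_superset[of "?m ` X"] by auto
      have "?m (mul x y) \<in> T" if "?m x \<in> T" "?m y \<in> T" for x y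
      proof -
        have "poly_mul mul (?m x) (?m y) \<in> T"
          using T(2) that by (auto simp: subalgebra_def)
        then show ?thesis by (simp add: poly_mul_monom)
      qed
      then show "S.subsemigroup {x \<in> S. ?m x \<in> T}"
        by (auto simp: S.subsemigroup_def S.mul_closed)
    qed
    then have mT: "?m x \<in> T" if "x \<in> S" for x
      using that XS(2) by blast
    have subT: "subspace T"
      using T(2) by (simp add: subalgebra_def)
    show "?A \<subseteq> T"
    proof
      fix p assume "p \<in> ?A"
      then show "p \<in> T"
      proof (induction rule: polys_over_induct)
        case (monom c i)
        then show ?case
          using subspace_scale[OF subT mT, of i c] by (simp add: smult_monom)
      next
        case (sum I g)
        then show ?case by (intro subspace_sum[OF subT])
      qed
    qed
  qed (fact \<open>?V \<subseteq> ?A\<close>)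
  then have gen: "generating_subspace ?V"
    using \<open>?V \<subseteq> ?A\<close> X(1) unfolding generating_subspace_def by blast
  have powers: "set_power (poly_mul mul) (?m ` X) k = ?m ` set_power mul X k" for k
  proof (induction k)
    case (Suc k)
    show ?case
    proof (cases k)
      case (Suc j)
      show ?thesis
      proof (intro equalityI subsetI)
        fix z assume "z \<in> set_power (poly_mul mul) (?m ` X) (Suc k)"
        then obtain x y where "x \<in> X" "y \<in> set_power mul X k" "z = poly_mul mul (?m x) (?m y)"
          using Suc.IH Suc by auto
        then show "z \<in> ?m ` set_power mul X (Suc k)"
          using Suc by (auto simp: poly_mul_monom)
      next
        fix z assume "z \<in> ?m ` set_power mul X (Suc k)"
        then obtain x y where "x \<in> X" "y \<in> set_power mul X k" "z = ?m (mul x y)"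
          using Suc by auto
        moreover have "?m (mul x y) = poly_mul mul (?m x) (?m y)" for x y
          by (simp add: poly_mul_monom)
        ultimately show "z \<in> set_power (poly_mul mul) (?m ` X) (Suc k)"
          using Suc.IH Suc by auto
      qed
    qed simp
  qed simp
  have "growth ?V n = semigroup_growth mul X n" for n
  proof -
    let ?U = "\<Union>k\<in>{1..n}. set_power mul X k"
    have "growth ?V n = dim (span (?m ` ?U))"
      unfolding growth_def span_Union_set_power_span[OF mXA] powers image_UN ..
    also have "\<dots> = card (?m ` ?U)"
      by (rule dim_span_eq_card_independent[OF independent_monoms])
    also have "\<dots> = card ?U"
      by (rule card_image) (auto intro!: inj_onI simp: monom_1_inject)
    finally show ?thesis
      by (simp add: semigroup_growth_def)
  qed
  then have "semigroup_growth mul X = growth ?V" by auto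
  moreover have "?A \<noteq> {0}"
  proof -
    obtain x where "x \<in> S" using S(2) by blast
    then have "?m x \<in> ?A" by (rule monom_in_polys_over)
    moreover have "?m x \<noteq> 0" by (simp add: monom_eq_0_iff)
    ultimately show ?thesis by blast
  qed
  ultimately show ?thesis
    using assoc_algebra_on_axioms gen unfolding algebra_growth_functions_def by blast
qed

section \<open>The characterization for the three classes\<close>

theorem algebra_growth_functions_equiv_model:
  assumes "d \<in> algebra_growth_functions scale"
  shows "\<exists>F\<in>model_functions. growth_equiv d F"
  using assms assoc_algebra_on.growth_equiv_model
  unfolding algebra_growth_functions_def by blast

theorem semigroup_growth_functions_equiv_model:
  assumes "d \<in> semigroup_growth_functions TYPE('s)"
  shows "\<exists>F\<in>model_functions. growth_equiv d F"
  using assms semigroup_growth_equiv_model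
  unfolding semigroup_growth_functions_def by blast

theorem model_function_realizable:
  assumes "F \<in> model_functions"
  shows "\<exists>d\<in>language_growth_functions TYPE(nat). growth_equiv F d"
    and "\<exists>d\<in>semigroup_growth_functions TYPE(nat). growth_equiv F d"
    and "\<exists>d\<in>algebra_growth_functions (smult :: 'k::field \<Rightarrow> 'k poly \<Rightarrow> 'k poly). growth_equiv F d"
proof -
  obtain L where L: "factor_closed L" "L \<noteq> {}" "L \<subseteq> lists {0, 1 :: nat}" "growth_equiv F (language_growth L)"
    using model_function_language[OF assms] by blast
  show "\<exists>d\<in>language_growth_functions TYPE(nat). growth_equiv F d"
    using language_growth_functionsI[OF _ L(1-3)] L(4) by blast
  obtain S :: "nat set" and mul Y where S: "semigroup_on S mul" "S \<noteq> {}" "finite Y" "semigroup_on.generates S mul Y"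
    "\<forall>n\<ge>1. semigroup_growth mul Y n = language_growth L n"
    using language_semigroup[OF _ L(1-3)] by blast
  have equiv: "growth_equiv F (semigroup_growth mul Y)"
    by (rule growth_equiv_cong[OF _ L(4)]) (simp add: S(5))
  then show "\<exists>d\<in>semigroup_growth_functions TYPE(nat). growth_equiv F d"
    using S unfolding semigroup_growth_functions_def by blast
  show "\<exists>d\<in>algebra_growth_functions (smult :: 'k \<Rightarrow> 'k poly \<Rightarrow> 'k poly). growth_equiv F d"
    using semigroup_algebra[OF S(1-4)] equiv by blast
qed

theorem theorem1p1:
  fixes scale :: "'k::field \<Rightarrow> 'v::ab_group_add \<Rightarrow> 'v"
  shows
    "\<comment> \<open>necessity\<close>
     (\<forall>d\<in>algebra_growth_functions scale. \<exists>F\<in>model_functions. growth_equiv d F) \<and>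
     \<comment> \<open>sufficiency\<close>
     (\<forall>F\<in>model_functions. \<exists>d\<in>language_growth_functions TYPE(nat). growth_equiv F d) \<and>
     \<comment> \<open>characterization for algebras over \<open>'k\<close>, semigroups and hereditary languages\<close>
     same_up_to_growth_equiv
       (algebra_growth_functions (smult :: 'k \<Rightarrow> 'k poly \<Rightarrow> 'k poly)) model_functions \<and>
     same_up_to_growth_equiv (semigroup_growth_functions TYPE(nat)) model_functions \<and>
     same_up_to_growth_equiv (language_growth_functions TYPE(nat)) model_functions \<and>
     \<comment> \<open>necessity for semigroups and hereditary languages in arbitrary types\<close>
     (\<forall>d\<in>semigroup_growth_functions TYPE('s). \<exists>F\<in>model_functions. growth_equiv d F) \<and>
     (\<forall>d\<in>language_growth_functions TYPE('x). \<exists>F\<in>model_functions. growth_equiv d F)"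
  unfolding same_up_to_growth_equiv_def
  by (intro conjI ballI algebra_growth_functions_equiv_model semigroup_growth_functions_equiv_model
      language_growth_functions_equiv_model model_function_realizable)

end
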